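(* Let $n\ge 1$ and let $f:\mathbb{R}^n\to\mathbb{R}_{>0}$ be a function such that: (i) $f$ is continuous; (ii) $f(x)=O((1+\|x\|_2)^{-n-\delta})$ for some $\delta>0$; (iii) $\sum_{\lambda\in\Lambda^*}|\widehat f(t\lambda)|<\infty$ for every lattice $\Lambda\subset\mathbb{R}^n$ and every $t>0$; (iv) $\widehat f$ is real-valued, nonnegative, and monotonically non-increasing on rays, i.e. $0\le \widehat f(tv)\le \widehat f(v)$ for all $v\in\mathbb{R}^n$ and all $t\ge 1$. Then the following statements hold for any lattice $\Lambda\subset\mathbb{R}^n$. (1) For any $v\in\mathbb{R}^n$ and $t\ge 1$, $$\sum_{\lambda\in\Lambda} f\!\left(\frac{\lambda+v}{t}\right)\ \le\ t^n\sum_{\lambda\in\Lambda} f(\lambda).$$ (2) For any subset $K\subset\mathbb{R}^n$ and any $v\in\mathbb{R}^n$, $$\sum_{\lambda\in\Lambda,\ \lambda+v\notin K} f(\lambda+v)\ \le\ \nu_f(K)\sum_{\lambda\in\Lambda} f(\lambda),$$ provided the right-hand side is finite, where $$\nu_f(K):=\inf_{0<u\le 1}\ \sup_{x\notin K}\ \frac{f(x)}{u^n f(ux)}.$$ (3) If no non-zero vectors of $\Lambda$ lie in $K\subset\mathbb{R}^n$, then for any $v\in\mathbb{R}^n$ $$\sum_{\lambda\in\Lambda^*}\widehat f(\lambda+v)\ \ge\ (1-2\nu_f(K))\sum_{\lambda\in\Lambda^*}\widehat f(\lambda),$$ provided that the left-hand side is convergent and $\nu_f(K)<\infty$.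
   Context: A lattice $\Lambda\subset\mathbb{R}^n$ is the set of integral linear combinations of some basis of $\mathbb{R}^n$. Its dual lattice is $\Lambda^*=\{x\in\mathbb{R}^n: x\cdot\lambda\in\mathbb{Z}\ \text{for all }\lambda\in\Lambda\}$. The Fourier transform is $\widehat f(x)=\int_{\mathbb{R}^n} f(r)e^{-2\pi i r\cdot x}\,dr$. $\|x\|_2$ is the Euclidean norm. In the definition of $\nu_f(K)$, $x$ ranges over $\mathbb{R}^n\setminus K$, and suprema are taken in $[0,\infty]$ (so the supremum over the empty set is $0$). *)

theory Defs
  imports "HOL-Analysis.Analysis" "HOL-Library.Landau_Symbols"
begin

definition is_lattice :: "(real ^ 'n) set \<Rightarrow> bool" where
  "is_lattice L \<longleftrightarrow> (\<exists>B. independent B \<and> span B = UNIV \<and>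
     L = range (\<lambda>c :: real ^ 'n \<Rightarrow> int. \<Sum>b\<in>B. of_int (c b) *\<^sub>R b))"

definition dual_lattice :: "(real ^ 'n) set \<Rightarrow> (real ^ 'n) set" where
  "dual_lattice L = {x. \<forall>l\<in>L. x \<bullet> l \<in> \<int>}"

definition fourier :: "(real ^ 'n \<Rightarrow> real) \<Rightarrow> real ^ 'n \<Rightarrow> complex" where
  "fourier f x =
     (LINT r|lborel. complex_of_real (f r) * exp (- 2 * of_real pi * \<i> * of_real (r \<bullet> x)))"

text \<open>Taking values in \<^typ>\<open>ennreal\<close> makes the supremum over the empty set \<open>0\<close> and lets
  unbounded suprema be \<open>\<infinity>\<close>. The embedding \<^const>\<open>ennreal\<close> truncates negative reals to \<open>0\<close>, so
  this is meaningful only for positive \<open>f\<close>.\<close>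

definition nu :: "(real ^ 'n \<Rightarrow> real) \<Rightarrow> (real ^ 'n) set \<Rightarrow> ennreal" where
  "nu f K = (INF u\<in>{0<..1::real}. SUP x\<in>- K. ennreal (f x / (u ^ CARD('n) * f (u *\<^sub>R x))))"

end

theory Submission
  imports Defs
begin

text \<open>
  Everything rests on Poisson summation (\<open>poisson_lattice\<close>): for a continuous function \<open>h\<close> that decays faster
  than the power \<open>- n\<close> of the norm and whose transform is absolutely summable over the dual lattice, the sum of \<open>h\<close>
  over the translate \<open>L + v\<close> is a constant multiple \<open>D > 0\<close> of the sum of the transform over the dual
  lattice, weighted by the character with argument \<open>v\<close>.

  Because the transform of \<open>f\<close> is nonnegative, the weighted dual sum is largest at \<open>v = 0\<close>. A dilation of \<open>f\<close> by
  \<open>t \<ge> 1\<close> contracts the transform, and monotonicity on rays shows that this decreases the dual sum, apart from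
  the factor \<open>t ^ n\<close>. This is the first claim (\<open>scaled_translate_le\<close>). For the second one (\<open>complement_le_nu\<close>),
  outside \<open>K\<close> the value \<open>f x\<close> is at most a supremum times \<open>u ^ n * f (u x)\<close>, and the first claim
  with \<open>t = 1 / u\<close> bounds the sum of the latter. For the third one (\<open>shifted_transform_ge\<close>), Poisson summation
  applied to \<open>f\<close> times a character writes the shifted dual sum as a twisted sum of \<open>f\<close> over \<open>L\<close>. There the
  origin contributes \<open>f 0\<close>, and the remaining vectors, which avoid \<open>K\<close>, contribute at least
  minus their mass; the second claim bounds that mass.

  Poisson summation is first proved for the integer points. The periodization of \<open>h\<close> and its Fourier series are
  continuous and have the same Fourier coefficients (\<open>decays_integral_has_sum\<close>, \<open>integral_wave\<close>), so they
  agree by a uniqueness theorem (\<open>fourier_uniqueness\<close>). The latter follows from the Stone-Weierstrass theorem on the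
  torus: a function orthogonal to all characters stays so after multiplication by any
  polynomial in the torus coordinates, hence it is orthogonal to itself. A general lattice is a linear
  image of the integer points, and the change of variables
  contributes the constant \<open>D\<close>.
\<close>

section \<open>Lebesgue integrals under linear bijections\<close>

lemma nn_integral_lborel_translate:
  fixes f :: "'a::euclidean_space \<Rightarrow> ennreal"
  assumes [measurable]: "f \<in> borel_measurable borel"
  shows "(\<integral>\<^sup>+x. f (x + a) \<partial>lborel) = (\<integral>\<^sup>+x. f x \<partial>lborel)"
proof -
  have "(\<integral>\<^sup>+x. f x \<partial>lborel) = (\<integral>\<^sup>+x. f x \<partial>distr lborel borel ((+) a))"
    by (simp add: lborel_distr_plus)
  also have "\<dots> = (\<integral>\<^sup>+x. f (x + a) \<partial>lborel)"
    by (subst nn_integral_distr) (auto simp: add.commute)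
  finally show ?thesis by simp
qed

text \<open>The pushforward of Lebesgue measure along a linear bijection is translation invariant, so it is a
  multiple of Lebesgue measure by the uniqueness of Haar measure. The proof is the classical
  two-fold Fubini argument: shifting one variable by the other exchanges the roles of
  \<open>f\<close> and a test function \<open>g\<close>, and taking \<open>g\<close> to be the indicator of the unit cube identifies the
  factor. It is the inverse of the absolute determinant; in the application it becomes the inverse
  covolume of a lattice and cancels from both sides of every inequality.\<close>

lemma nn_integral_linear_bij:
  fixes A :: "'a::euclidean_space \<Rightarrow> 'a"
  assumes A: "linear A" "bij A"
  obtains c where "c > 0"
    "\<And>f. f \<in> borel_measurable borel \<Longrightarrow> (\<integral>\<^sup>+x. f (A x) \<partial>lborel) = ennreal c * (\<integral>\<^sup>+x. f x \<partial>lborel)"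
proof -
  have contA: "continuous_on S A" for S
    using A(1) linear_continuous_on linear_conv_bounded_linear by blast
  have [measurable]: "A \<in> borel_measurable borel"
    using contA by (intro borel_measurable_continuous_onI)
  define B where "B = inv A"
  have linB: "linear B"
    unfolding B_def using A by (simp add: bij_is_inj bij_is_surj inj_linear_imp_inv_linear)
  have AB: "A (B y) = y" and BA: "B (A y) = y" for y
    using A(2) by (auto simp: B_def bij_is_surj surj_f_inv_f bij_is_inj)
  have Aadd: "A (x + B y) = A x + y" for x y
    by (simp add: linear_add[OF A(1)] AB)
  \<comment> \<open>Both double integrals below have the integrand \<open>f (A x + y) * g y\<close> up to a shift of one variable.\<close>
  have exchange: "(\<integral>\<^sup>+x. f (A x) \<partial>lborel) * (\<integral>\<^sup>+y. g y \<partial>lborel)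
      = (\<integral>\<^sup>+y. f y \<partial>lborel) * (\<integral>\<^sup>+x. g (- A x) \<partial>lborel)"
    if [measurable]: "f \<in> borel_measurable borel" "g \<in> borel_measurable borel"
    for f g :: "'a \<Rightarrow> ennreal"
  proof -
    have shiftf: "(\<integral>\<^sup>+x. f (A x + y) \<partial>lborel) = (\<integral>\<^sup>+x. f (A x) \<partial>lborel)" for y
      using nn_integral_lborel_translate[of "\<lambda>x. f (A x)" "B y"] by (simp add: Aadd)
    have shiftg: "(\<integral>\<^sup>+x. g (y - A x) \<partial>lborel) = (\<integral>\<^sup>+x. g (- A x) \<partial>lborel)" for y
      using nn_integral_lborel_translate[of "\<lambda>x. g (y - A x)" "B y"] by (simp add: Aadd)
    have "(\<integral>\<^sup>+x. f (A x) \<partial>lborel) * (\<integral>\<^sup>+y. g y \<partial>lborel)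
        = (\<integral>\<^sup>+y. (\<integral>\<^sup>+x. f (A x + y) * g y \<partial>lborel) \<partial>lborel)"
      by (simp add: nn_integral_multc shiftf nn_integral_cmult)
    also have "\<dots> = (\<integral>\<^sup>+x. (\<integral>\<^sup>+y. f (A x + y) * g y \<partial>lborel) \<partial>lborel)"
      by (rule lborel_pair.Fubini') measurable
    also have "\<dots> = (\<integral>\<^sup>+x. (\<integral>\<^sup>+y. f y * g (y - A x) \<partial>lborel) \<partial>lborel)"
    proof (rule nn_integral_cong)
      fix x
      show "(\<integral>\<^sup>+y. f (A x + y) * g y \<partial>lborel) = (\<integral>\<^sup>+y. f y * g (y - A x) \<partial>lborel)"
        using nn_integral_lborel_translate[of "\<lambda>y. f y * g (y - A x)" "A x"]
        by (simp add: add.commute)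
    qed
    also have "\<dots> = (\<integral>\<^sup>+y. (\<integral>\<^sup>+x. f y * g (y - A x) \<partial>lborel) \<partial>lborel)"
      by (rule lborel_pair.Fubini') measurable
    also have "\<dots> = (\<integral>\<^sup>+y. f y \<partial>lborel) * (\<integral>\<^sup>+x. g (- A x) \<partial>lborel)"
      by (simp add: nn_integral_cmult shiftg nn_integral_multc)
    finally show ?thesis .
  qed
  define Q :: "'a set" where "Q = cbox 0 One"
  define C where "C = (\<integral>\<^sup>+x. indicator Q (- A x) \<partial>lborel)"
  have [measurable]: "Q \<in> sets borel" by (simp add: Q_def)
  have Q1: "(\<integral>\<^sup>+y. indicator Q y \<partial>lborel) = 1"
    using content_unit[where 'a='a]
    by (simp add: Q_def emeasure_eq_ennreal_measure emeasure_lborel_cbox_finite[THEN less_imp_neq])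
  have main: "(\<integral>\<^sup>+x. f (A x) \<partial>lborel) = C * (\<integral>\<^sup>+x. f x \<partial>lborel)"
    if "f \<in> borel_measurable borel" for f :: "'a \<Rightarrow> ennreal"
    using exchange[OF that, of "indicator Q"] by (simp add: Q1 C_def mult.commute)
  have "C \<noteq> 0"
  proof
    assume "C = 0"
    then have "emeasure lborel (UNIV :: 'a set) = 0"
      using main[of "\<lambda>_. 1"] by simp
    then show False by (simp add: emeasure_lborel_UNIV)
  qed
  have "C < \<infinity>"
  proof -
    have "bounded ((\<lambda>y. B (- y)) ` Q)"
      using linB linear_continuous_on_compose[of Q uminus B]
      by (intro compact_imp_bounded compact_continuous_image) (auto simp: Q_def continuous_on_minus)
    moreover have "{x. - A x \<in> Q} \<subseteq> (\<lambda>y. B (- y)) ` Q"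
      using BA by (force intro: rev_image_eqI)
    ultimately have "bounded {x. - A x \<in> Q}"
      using bounded_subset by blast
    then have "emeasure lborel {x. - A x \<in> Q} < \<infinity>"
      by (rule emeasure_bounded_finite)
    moreover have "C = (\<integral>\<^sup>+x. indicator {x. - A x \<in> Q} x \<partial>lborel)"
      unfolding C_def by (intro nn_integral_cong) (auto simp: indicator_def)
    ultimately show ?thesis by simp
  qed
  with \<open>C \<noteq> 0\<close> obtain c where "c > 0" "C = ennreal c"
    by (cases C) (auto simp: less_le)
  with main that show thesis by blast
qed

lemma lebesgue_integral_linear_bij:
  fixes A :: "'a::euclidean_space \<Rightarrow> 'a"
  assumes A: "linear A" "bij A"
  obtains c where "c > 0"
    "\<And>h :: 'a \<Rightarrow> complex. h \<in> borel_measurable borel \<Longrightarrow> (LINT x|lborel. h (A x)) = complex_of_real c * (LINT x|lborel. h x)"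
proof -
  obtain c where c: "c > 0" and
    nn: "\<And>f. f \<in> borel_measurable borel \<Longrightarrow> (\<integral>\<^sup>+x. f (A x) \<partial>lborel) = ennreal c * (\<integral>\<^sup>+x. f x \<partial>lborel)"
    using nn_integral_linear_bij[OF A] by blast
  have contA: "continuous_on UNIV A"
    using A(1) linear_continuous_on linear_conv_bounded_linear by blast
  have [measurable]: "A \<in> borel_measurable borel"
    using contA by (intro borel_measurable_continuous_onI)
  have D: "distr lborel borel A = density lborel (\<lambda>_. ennreal c)"
  proof (rule measure_eqI)
    fix X assume "X \<in> sets (distr lborel borel A)"
    then have [measurable]: "X \<in> sets borel" by simp
    have "emeasure (distr lborel borel A) X = (\<integral>\<^sup>+x. indicator X x \<partial>distr lborel borel A)"
      by simp
    also have "\<dots> = ennreal c * (\<integral>\<^sup>+x. indicator X x \<partial>lborel)"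
      by (subst nn_integral_distr) (simp_all add: nn)
    also have "\<dots> = emeasure (density lborel (\<lambda>_. ennreal c)) X"
      by (simp add: emeasure_density nn_integral_cmult)
    finally show "emeasure (distr lborel borel A) X = emeasure (density lborel (\<lambda>_. ennreal c)) X" .
  qed simp
  have "(LINT x|lborel. h (A x)) = c * (LINT x|lborel. h x)"
    if [measurable]: "h \<in> borel_measurable borel" for h :: "'a \<Rightarrow> complex"
  proof -
    have "(LINT x|lborel. h (A x)) = (LINT x|distr lborel borel A. h x)"
      by (subst integral_distr) auto
    also have "\<dots> = c * (LINT x|lborel. h x)"
      unfolding D using c by (subst integral_density) (auto simp: scaleR_conv_of_real)
    finally show ?thesis .
  qed
  with c that show thesis by blast
qed

text \<open>For a dilation the value of the factor matters: it is the \<open>t ^ n\<close> of the first inequality.\<close>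

lemma lebesgue_integral_scale:
  fixes h :: "real ^ 'n \<Rightarrow> complex"
  assumes [measurable]: "h \<in> borel_measurable borel" and t: "t > 0"
  shows "(LINT x|lborel. h x) = of_real (t ^ CARD('n)) * (LINT x|lborel. h (t *\<^sub>R x))"
proof -
  have "(LINT x|lborel. h x) = (LINT x|density (distr lborel borel (\<lambda>x. 0 + t *\<^sub>R x)) (\<lambda>_. ennreal (\<bar>t\<bar> ^ DIM(real ^ 'n))). h x)"
    using lborel_affine[of t "0 :: real ^ 'n"] t by simp
  also have "\<dots> = of_real (t ^ CARD('n)) * (LINT x|lborel. h (t *\<^sub>R x))"
    using t by (subst integral_density; simp?; subst integral_distr; simp add: scaleR_conv_of_real[where 'a=complex])
  finally show ?thesis .
qed

section \<open>Integer points and convergence of lattice sums\<close>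

definition integer_points :: "(real ^ 'n) set" where
  "integer_points = {x. \<forall>i. x $ i \<in> \<int>}"

lemma integer_points_closed [simp]:
  "0 \<in> integer_points"
  "a \<in> integer_points \<Longrightarrow> b \<in> integer_points \<Longrightarrow> a + b \<in> integer_points"
  "a \<in> integer_points \<Longrightarrow> b \<in> integer_points \<Longrightarrow> a - b \<in> integer_points"
  "a \<in> integer_points \<Longrightarrow> - a \<in> integer_points"
  "axis i 1 \<in> integer_points"
  by (auto simp: integer_points_def axis_def)

lemma inner_integer_points: "a \<in> integer_points \<Longrightarrow> b \<in> integer_points \<Longrightarrow> a \<bullet> b \<in> \<int>"
  unfolding integer_points_def inner_vec_def by (auto intro!: Ints_sum Ints_mult)

lemma bij_betw_add_integer_points:
  assumes a: "a \<in> integer_points"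
  shows "bij_betw ((+) a) integer_points integer_points"
  using a integer_points_closed(3)[OF _ a]
  by (intro bij_betwI[of _ _ _ "\<lambda>y. y - a"]) auto

lemma countable_integer_points: "countable integer_points"
proof -
  have "integer_points \<subseteq> range (\<lambda>z :: int ^ 'n. \<chi> i. of_int (z $ i))"
  proof
    fix x :: "real ^ 'n" assume "x \<in> integer_points"
    then have "x = (\<chi> i. of_int ((\<chi> i. \<lfloor>x $ i\<rfloor>) $ i))"
      by (auto simp: vec_eq_iff integer_points_def)
    then show "x \<in> range (\<lambda>z :: int ^ 'n. \<chi> i. of_int (z $ i))" by blast
  qed
  then show ?thesis using countable_subset by blast
qed

lemma infinite_integer_points: "infinite (integer_points :: (real ^ 'n) set)"
proof -
  have "inj (\<lambda>k::nat. \<chi> i::'n. real k)" by (auto simp: inj_def vec_eq_iff)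
  moreover have "range (\<lambda>k::nat. \<chi> i::'n. real k) \<subseteq> integer_points"
    by (auto simp: integer_points_def)
  ultimately show ?thesis using infinite_iff_countable_subset by blast
qed

lemma summable_on_Ints_powr:
  assumes "s > 1"
  shows "(\<lambda>x::real. (1 + \<bar>x\<bar>) powr (- s)) summable_on \<int>"
proof -
  let ?w = "\<lambda>x::real. (1 + \<bar>x\<bar>) powr (- s)"
  have "summable (\<lambda>k. real k powr (- s))"
    using assms by (simp add: summable_real_powr_iff)
  then have "summable (\<lambda>k. real (Suc k) powr (- s))"
    by (subst summable_Suc_iff)
  then have sm: "summable (\<lambda>k::nat. ?w (real k))"
    by (simp add: add.commute)
  then have N: "(\<lambda>k::nat. ?w (real k)) summable_on UNIV"
    by (intro norm_summable_imp_summable_on) simp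
  have 1: "?w summable_on range real"
    by (subst summable_on_reindex) (use N in \<open>auto simp: o_def inj_def\<close>)
  have 2: "?w summable_on range (\<lambda>k. - real k)"
    by (subst summable_on_reindex) (use N in \<open>auto simp: o_def inj_def\<close>)
  have "?w summable_on (range real \<union> (range (\<lambda>k. - real k) - range real))"
    by (intro summable_on_Un_disjoint 1 summable_on_subset_banach[OF 2]) auto
  moreover have "range real \<union> (range (\<lambda>k. - real k) - range real) = (\<int> :: real set)"
  proof -
    have "x \<in> range real \<union> range (\<lambda>k. - real k)" if x: "x \<in> \<int>" for x :: real
    proof -
      obtain k :: int where "x = of_int k" using x by (rule Ints_cases)
      have "x = real (nat k) \<or> x = - real (nat (- k))"
        using \<open>x = of_int k\<close> by (cases "k \<ge> 0") auto
      then show ?thesis by auto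
    qed
    then show ?thesis by (auto intro!: Ints_minus)
  qed
  ultimately show ?thesis by simp
qed

text \<open>A product of one-variable weights bounds any finite partial sum by a sum over a finite grid, and that
  sum factorizes. This is how convergence in dimension \<open>n\<close> is reduced to dimension one.\<close>

lemma summable_on_integer_points_prod:
  assumes w: "w summable_on \<int>" and w0: "\<And>x. 0 \<le> w x"
  shows "(\<lambda>m :: real ^ 'n. \<Prod>i\<in>UNIV. w (m $ i) :: real) summable_on integer_points"
proof (rule nonneg_bdd_above_summable_on)
  show "0 \<le> (\<Prod>i\<in>UNIV. w (m $ i))" for m :: "real ^ 'n"
    by (simp add: prod_nonneg w0)
  show "bdd_above (sum (\<lambda>m :: real ^ 'n. \<Prod>i\<in>UNIV. w (m $ i)) ` {F. F \<subseteq> integer_points \<and> finite F})"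
  proof (rule bdd_aboveI2)
    fix F :: "(real ^ 'n) set" assume F: "F \<in> {F. F \<subseteq> integer_points \<and> finite F}"
    define B where "B = (\<Union>i. (\<lambda>m. m $ i) ` F)"
    have B: "finite B" "B \<subseteq> \<int>" using F by (auto simp: B_def integer_points_def)
    have "(\<Sum>m\<in>F. \<Prod>i\<in>UNIV. w (m $ i)) = (\<Sum>g\<in>vec_nth ` F. \<Prod>i\<in>UNIV. w (g i))"
      by (subst sum.reindex) (auto simp: inj_on_def vec_nth_inject)
    also have "\<dots> \<le> (\<Sum>g\<in>PiE (UNIV :: 'n set) (\<lambda>_. B). \<Prod>i\<in>UNIV. w (g i))"
    proof (rule sum_mono2)
      show "finite (PiE (UNIV::'n set) (\<lambda>_. B))" using B by (simp add: finite_PiE)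
      show "vec_nth ` F \<subseteq> PiE UNIV (\<lambda>_. B)" by (auto simp: B_def)
    qed (simp add: prod_nonneg w0)
    also have "\<dots> = (\<Prod>i\<in>(UNIV::'n set). \<Sum>x\<in>B. w x)"
      using B by (intro prod_sum_PiE[symmetric]) auto
    also have "\<dots> \<le> (\<Prod>i\<in>(UNIV::'n set). infsum w \<int>)"
    proof (rule prod_mono)
      show "0 \<le> sum w B \<and> sum w B \<le> infsum w \<int>" for i :: 'n
        using finite_sum_le_infsum[of w \<int> B] w B by (simp add: w0 sum_nonneg)
    qed
    finally show "(\<Sum>m\<in>F. \<Prod>i\<in>UNIV. w (m $ i)) \<le> (\<Prod>i\<in>(UNIV::'n set). infsum w \<int>)" .
  qed
qed

section \<open>Decaying functions and their periodization\<close>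

text \<open>The decay hypothesis as a pointwise bound on the whole space, in a form that is stable under linear
  bijections and under multiplication by characters.\<close>

definition decays :: "(real ^ 'n \<Rightarrow> complex) \<Rightarrow> bool" where
  "decays h \<longleftrightarrow> continuous_on UNIV h \<and>
    (\<exists>C \<delta>. \<delta> > 0 \<and> (\<forall>x. norm (h x) \<le> C * (1 + norm x) powr (- real CARD('n) - \<delta>)))"

lemma decays_borel_measurable: "decays h \<Longrightarrow> h \<in> borel_measurable borel"
  unfolding decays_def by (blast intro: borel_measurable_continuous_onI)

lemma decays_mult_unimodular:
  fixes h :: "real ^ 'n \<Rightarrow> complex"
  assumes "decays h" "continuous_on UNIV c" "\<And>x. norm (c x) \<le> 1"
  shows "decays (\<lambda>x. h x * c x)"
proof -
  obtain C \<delta> where "\<delta> > 0" and C: "\<And>x. norm (h x) \<le> C * (1 + norm x) powr (- real CARD('n) - \<delta>)"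
    using assms(1) by (auto simp: decays_def)
  have "norm (h x * c x) \<le> C * (1 + norm x) powr (- real CARD('n) - \<delta>)" for x
    using mult_mono[OF C[of x] assms(3)[of x]] C[of x] norm_ge_zero[of "h x"]
    by (simp add: norm_mult) 
  with \<open>\<delta> > 0\<close> show ?thesis
    using assms by (auto simp: decays_def intro!: continuous_intros)
qed

lemma decays_comp_linear:
  fixes A :: "real ^ 'n \<Rightarrow> real ^ 'n"
  assumes h: "decays h" and A: "linear A" "bij A"
  shows "decays (\<lambda>x. h (A x))"
proof -
  obtain C \<delta> where "\<delta> > 0" and C: "\<And>x. norm (h x) \<le> C * (1 + norm x) powr (- real CARD('n) - \<delta>)"
    using h by (auto simp: decays_def)
  define p where "p = real CARD('n) + \<delta>"
  have "p > 0" using \<open>\<delta> > 0\<close> by (simp add: p_def)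
  have C: "norm (h x) \<le> C * (1 + norm x) powr (- p)" for x
    using C[of x] by (simp add: p_def)
  have "0 \<le> C" using order_trans[OF norm_ge_zero C[of 0]] by simp
  have "linear (inv A)" using A by (auto simp: bij_def intro: inj_linear_imp_inv_linear)
  then obtain B where B: "B > 0" "\<And>y. norm (inv A y) \<le> B * norm y"
    using linear_bounded_pos by blast
  \<comment> \<open>The maximum with \<open>1\<close> absorbs the summand \<open>1\<close> in \<open>1 + norm x\<close>.\<close>
  define K where "K = max 1 B"
  have K: "1 + norm x \<le> K * (1 + norm (A x))" for x
  proof -
    have "norm x \<le> B * norm (A x)" using B(2)[of "A x"] A by (simp add: bij_is_inj)
    also have "\<dots> \<le> K * norm (A x)" by (intro mult_right_mono) (auto simp: K_def)
    finally show ?thesis by (simp add: K_def algebra_simps)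
  qed
  have "norm (h (A x)) \<le> (C * K powr p) * (1 + norm x) powr (- p)" for x
  proof -
    have "(1 + norm (A x)) powr (- p) \<le> ((1 + norm x) / K) powr (- p)"
      using K[of x] \<open>p > 0\<close> norm_ge_zero[of x]
      by (intro powr_mono2') (auto simp: K_def divide_le_eq mult.commute intro!: divide_pos_pos add_pos_nonneg)
    also have "\<dots> = K powr p * (1 + norm x) powr (- p)"
      by (subst powr_divide) (auto simp: K_def powr_minus field_simps)
    finally have "C * (1 + norm (A x)) powr (- p) \<le> C * (K powr p * (1 + norm x) powr (- p))"
      using \<open>0 \<le> C\<close> by (rule mult_left_mono)
    then show ?thesis using C[of "A x"] by simp
  qed
  moreover have "continuous_on UNIV (\<lambda>x. h (A x))"
    using h A linear_continuous_on[of A UNIV]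
    unfolding decays_def linear_conv_bounded_linear by (blast intro: continuous_on_compose2)
  ultimately show ?thesis using \<open>\<delta> > 0\<close> by (auto simp: decays_def p_def)
qed

lemma norm_unit_cube_le: "x \<in> cbox 0 (1 :: real ^ 'n) \<Longrightarrow> norm x \<le> real CARD('n)"
proof -
  assume x: "x \<in> cbox 0 (1 :: real ^ 'n)"
  have "norm x \<le> (\<Sum>i\<in>UNIV. \<bar>x $ i\<bar>)" by (rule norm_le_l1_cart)
  also have "\<dots> \<le> (\<Sum>i\<in>(UNIV::'n set). 1)"
    using x by (intro sum_mono) (auto simp: mem_box_cart abs_le_iff intro: order_trans)
  finally show ?thesis by simp
qed

text \<open>A summable bound for all integer translates on the unit cube. As \<open>1 + norm m\<close> dominates every
  \<open>1 + \<bar>m $ i\<bar>\<close>, the power \<open>- p\<close> of \<open>1 + norm m\<close> is at most the product over the \<open>n\<close> coordinates of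
  the powers \<open>- p / n\<close>, and \<open>p > n\<close> makes each one-variable exponent smaller than \<open>- 1\<close>.\<close>

lemma decays_majorant:
  fixes h :: "real ^ 'n \<Rightarrow> complex"
  assumes "decays h"
  obtains M where "M summable_on integer_points" "\<And>m. 0 \<le> M m"
    "\<And>x m. x \<in> cbox 0 1 \<Longrightarrow> m \<in> integer_points \<Longrightarrow> norm (h (x + m)) \<le> M m"
proof -
  let ?n = "real CARD('n)"
  obtain C \<delta> where "\<delta> > 0" and C: "\<And>x. norm (h x) \<le> C * (1 + norm x) powr (- real CARD('n) - \<delta>)"
    using assms by (auto simp: decays_def)
  define p where "p = ?n + \<delta>"
  have "p > ?n" using \<open>\<delta> > 0\<close> by (simp add: p_def)
  have n: "?n > 0" by simp
  have "p > 0" using \<open>p > ?n\<close> n by linarith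
  have C: "norm (h x) \<le> C * (1 + norm x) powr (- p)" for x
    using C[of x] by (simp add: p_def)
  have "0 \<le> C" using order_trans[OF norm_ge_zero C[of 0]] by simp
  define M :: "real ^ 'n \<Rightarrow> real" where
    "M m = (C * (1 + ?n) powr p) * (\<Prod>i\<in>UNIV. (1 + \<bar>m $ i\<bar>) powr (- (p / ?n)))" for m
  show thesis
  proof
    have "p / ?n > 1" using \<open>p > ?n\<close> n by (simp add: field_simps)
    then show "M summable_on integer_points"
      unfolding M_def by (intro summable_on_cmult_right summable_on_integer_points_prod summable_on_Ints_powr) auto
    show "0 \<le> M m" for m unfolding M_def using \<open>0 \<le> C\<close> by (intro mult_nonneg_nonneg prod_nonneg) auto
    fix x m :: "real ^ 'n" assume x: "x \<in> cbox 0 1"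
    have "1 + norm m \<le> 1 + norm (x + m) + norm x"
      using norm_triangle_ineq4[of "x + m" x] by simp
    also have "\<dots> \<le> (1 + ?n) * (1 + norm (x + m))"
    proof -
      have "(1 + ?n) * (1 + norm (x + m)) = 1 + norm (x + m) + ?n + ?n * norm (x + m)"
        by (simp add: algebra_simps)
      moreover have "0 \<le> ?n * norm (x + m)" by simp
      ultimately show ?thesis using norm_unit_cube_le[OF x] by linarith
    qed
    finally have le: "(1 + norm m) / (1 + ?n) \<le> 1 + norm (x + m)"
      using n by (simp add: field_simps)
    have "(1 + norm (x + m)) powr (- p) \<le> ((1 + norm m) / (1 + ?n)) powr (- p)"
      using le \<open>p > 0\<close> n norm_ge_zero[of m] by (intro powr_mono2') (auto intro!: divide_pos_pos add_pos_nonneg)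
    also have "\<dots> = (1 + ?n) powr p * (1 + norm m) powr (- p)"
      using n by (subst powr_divide) (auto simp: powr_minus field_simps)
    also have "(1 + norm m) powr (- p) = (\<Prod>i\<in>(UNIV::'n set). (1 + norm m) powr (- (p / ?n)))"
    proof -
      have "1 + norm m \<noteq> 0" using norm_ge_zero[of m] by linarith
      then show ?thesis using n by (simp add: powr_power)
    qed
    also have "\<dots> \<le> (\<Prod>i\<in>UNIV. (1 + \<bar>m $ i\<bar>) powr (- (p / ?n)))"
      using \<open>p > 0\<close> n component_le_norm_cart[of m] by (intro prod_mono conjI powr_mono2') auto
    finally have "C * (1 + norm (x + m)) powr (- p)
        \<le> C * ((1 + ?n) powr p * (\<Prod>i\<in>UNIV. (1 + \<bar>m $ i\<bar>) powr (- (p / ?n))))"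
      using \<open>0 \<le> C\<close> by (intro mult_left_mono) auto
    then show "norm (h (x + m)) \<le> M m" using C[of "x + m"] by (simp add: M_def)
  qed
qed

text \<open>By the Weierstrass test the partial sums converge uniformly, which carries both continuity
  and the integral to the limit. It is used twice: for the periodization of a function on space
  and for the Fourier series.\<close>

lemma integrate_series:
  fixes u :: "'m \<Rightarrow> 'a::euclidean_space \<Rightarrow> complex"
  assumes M: "M summable_on I" and bound: "\<And>m x. m \<in> I \<Longrightarrow> x \<in> cbox a b \<Longrightarrow> norm (u m x) \<le> M m"
    and cont: "\<And>m. m \<in> I \<Longrightarrow> continuous_on (cbox a b) (u m)"
  shows "continuous_on (cbox a b) (\<lambda>x. \<Sum>\<^sub>\<infinity>m\<in>I. u m x)"
    and "((\<lambda>m. integral (cbox a b) (u m)) has_sum integral (cbox a b) (\<lambda>x. \<Sum>\<^sub>\<infinity>m\<in>I. u m x)) I"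
proof -
  \<comment> \<open>Extended by zero, so that all finite partial sums are continuous, also those that leave \<open>I\<close>.\<close>
  define v where "v m = (if m \<in> I then u m else (\<lambda>_. 0))" for m
  have contv: "continuous_on (cbox a b) (v m)" for m using cont by (auto simp: v_def)
  have eq: "(\<Sum>\<^sub>\<infinity>m\<in>I. v m x) = (\<Sum>\<^sub>\<infinity>m\<in>I. u m x)" for x
    by (intro infsum_cong) (simp add: v_def)
  have ul: "uniform_limit (cbox a b) (\<lambda>F x. \<Sum>m\<in>F. v m x) (\<lambda>x. \<Sum>\<^sub>\<infinity>m\<in>I. u m x) (finite_subsets_at_top I)"
    unfolding eq[symmetric] by (rule Weierstrass_m_test_general[OF _ M]) (auto simp: v_def bound)
  have contF: "continuous_on (cbox a b) (\<lambda>x. \<Sum>m\<in>F. v m x)" for F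
    by (intro continuous_on_sum contv)
  show "continuous_on (cbox a b) (\<lambda>x. \<Sum>\<^sub>\<infinity>m\<in>I. u m x)"
    by (rule uniform_limit_theorem[OF _ ul]) (auto simp: contF)
  obtain J J' where J: "\<And>F. ((\<lambda>x. \<Sum>m\<in>F. v m x) has_integral J F) (cbox a b)"
    "((\<lambda>x. \<Sum>\<^sub>\<infinity>m\<in>I. u m x) has_integral J') (cbox a b)" "(J \<longlongrightarrow> J') (finite_subsets_at_top I)"
    using uniform_limit_integral_cbox[OF ul contF] by (metis finite_subsets_at_top_neq_bot)
  have "((\<lambda>m. integral (cbox a b) (v m)) has_sum J') I"
    unfolding has_sum_def
  proof (rule Lim_transform_eventually[OF J(3)])
    show "\<forall>\<^sub>F F in finite_subsets_at_top I. J F = (\<Sum>m\<in>F. integral (cbox a b) (v m))"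
    proof (rule eventually_finite_subsets_at_top_weakI)
      fix F assume F: "finite F" "F \<subseteq> I"
      have "((\<lambda>x. \<Sum>m\<in>F. v m x) has_integral (\<Sum>m\<in>F. integral (cbox a b) (v m))) (cbox a b)"
        by (intro has_integral_sum F integrable_integral integrable_continuous contv)
      then show "J F = (\<Sum>m\<in>F. integral (cbox a b) (v m))"
        using J(1) has_integral_unique by blast
    qed
  qed
  then show "((\<lambda>m. integral (cbox a b) (u m)) has_sum integral (cbox a b) (\<lambda>x. \<Sum>\<^sub>\<infinity>m\<in>I. u m x)) I"
    using integral_unique[OF J(2)] by (subst has_sum_cong[where g="\<lambda>m. integral (cbox a b) (v m)"]) (auto simp: v_def)
qed

definition unit_cell :: "(real ^ 'n) set" where
  "unit_cell = {x. \<forall>i. 0 \<le> x $ i \<and> x $ i < 1}"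

lemma unit_cell_borel [measurable]: "unit_cell \<in> sets borel"
proof -
  have [measurable]: "(\<lambda>x::real ^ 'n. x $ i) \<in> borel_measurable borel" for i
    by (intro borel_measurable_continuous_onI continuous_intros)
  have "{x \<in> space borel. \<forall>i. 0 \<le> x $ i \<and> x $ i < 1} \<in> sets (borel :: (real ^ 'n) measure)"
    by measurable
  then show ?thesis by (simp add: unit_cell_def)
qed

lemma unit_cell_translate_exists:
  obtains m where "m \<in> integer_points" "x - m \<in> unit_cell"
proof
  show "(\<chi> i. of_int \<lfloor>x $ i\<rfloor>) \<in> integer_points"
    by (simp add: integer_points_def)
  show "x - (\<chi> i. of_int \<lfloor>x $ i\<rfloor>) \<in> unit_cell"
    by (auto simp: unit_cell_def) linarith
qed

lemma unit_cell_subset_cbox: "unit_cell \<subseteq> cbox 0 1"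
  by (auto simp: unit_cell_def mem_box_cart less_imp_le)

lemma unit_cell_disjoint:
  assumes "x - a \<in> unit_cell" "x - b \<in> unit_cell" "a \<in> integer_points" "b \<in> integer_points"
  shows "a = b"
proof -
  have "a $ i = b $ i" for i
  proof -
    have "a $ i - b $ i \<in> \<int>" using assms by (auto simp: integer_points_def)
    moreover have "\<bar>a $ i - b $ i\<bar> < 1" using assms(1,2) unfolding unit_cell_def
      by (auto dest!: spec[of _ i])
    ultimately have "a $ i - b $ i = 0" by (rule Ints_nonzero_abs_less1)
    then show ?thesis by simp
  qed
  then show ?thesis by (simp add: vec_eq_iff)
qed

lemma one_vec_eq_One: "(1 :: real ^ 'n) = One"
proof -
  have "(One :: real ^ 'n) $ i = 1" for i
    using inner_sum_left_Basis[of "axis i (1::real)" "\<lambda>_. 1"]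
    by (simp add: cart_eq_inner_axis axis_in_Basis_iff del: sum_component)
  then show ?thesis by (simp add: vec_eq_iff del: sum_component)
qed

lemma content_unit_cube: "measure lborel (cbox 0 (1 :: real ^ 'n)) = 1"
  by (simp add: one_vec_eq_One content_unit)

lemma lebesgue_integral_translate:
  fixes h :: "real ^ 'n \<Rightarrow> complex"
  assumes [measurable]: "h \<in> borel_measurable borel"
  shows "(LINT x|lborel. h (x + a)) = (LINT x|lborel. h x)"
proof -
  have "(LINT x|lborel. h x) = (LINT x|distr lborel borel ((+) a). h x)"
    by (simp add: lborel_distr_plus)
  also have "\<dots> = (LINT x|lborel. h (x + a))"
    by (subst integral_distr) (auto simp: add.commute)
  finally show ?thesis by simp
qed

text \<open>The half-open cell tiles space exactly, whereas the closed cube is compact. The two differ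
  by a null set, so integrals can be moved from one to the other.\<close>

lemma lebesgue_integral_translated_cell:
  fixes h :: "real ^ 'n \<Rightarrow> complex"
  assumes cont: "continuous_on UNIV h"
  shows "(LINT x:{x. x - m \<in> unit_cell}|lborel. h x) = integral (cbox 0 1) (\<lambda>x. h (x + m))"
proof -
  have [measurable]: "h \<in> borel_measurable borel"
    using cont by (rule borel_measurable_continuous_onI)
  have conthm: "continuous_on S (\<lambda>x. h (x + m))" for S
    by (rule continuous_on_compose2[OF cont]) (auto intro: continuous_intros)
  have "(LINT x:{x. x - m \<in> unit_cell}|lborel. h x) = (LINT x|lborel. indicator {x. x - m \<in> unit_cell} (x + m) *\<^sub>R h (x + m))"
    unfolding set_lebesgue_integral_def by (rule lebesgue_integral_translate[symmetric]) measurable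
  also have "\<dots> = (LINT x|lborel. indicator unit_cell x *\<^sub>R h (x + m))"
    by (intro Bochner_Integration.integral_cong) (auto simp: indicator_def)
  also have "\<dots> = (LINT x|lborel. indicator (cbox 0 1) x *\<^sub>R h (x + m))"
  proof (rule integral_cong_AE)
    have "cbox 0 1 - box 0 (1 :: real ^ 'n) \<in> null_sets lborel"
      using negligible_frontier_interval[of 0 "1 :: real ^ 'n"]
      by (simp add: negligible_iff_null_sets null_sets_completion_iff)
    then show "AE x in lborel. indicator unit_cell x *\<^sub>R h (x + m) = indicator (cbox 0 1) x *\<^sub>R h (x + m)"
    proof (rule AE_I')
      have "box 0 1 \<subseteq> (unit_cell :: (real ^ 'n) set)"
        by (auto simp: unit_cell_def mem_box_cart intro: less_imp_le)
      then show "{x \<in> space lborel. indicator unit_cell x *\<^sub>R h (x + m) \<noteq> indicator (cbox 0 1) x *\<^sub>R h (x + m)}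
          \<subseteq> cbox 0 1 - box 0 (1 :: real ^ 'n)"
        using unit_cell_subset_cbox by (auto simp: indicator_def split: if_splits)
    qed
  qed auto
  also have "\<dots> = (LINT x:cbox 0 1|lborel. h (x + m))"
    by (simp add: set_lebesgue_integral_def)
  also have "\<dots> = integral (cbox 0 1) (\<lambda>x. h (x + m))"
    by (rule set_borel_integral_eq_integral)
      (simp add: set_integrable_def borel_integrable_compact conthm)
  finally show ?thesis .
qed

text \<open>Unfolding: the integer translates of the half-open cell partition space. The majorant shows both that
  \<open>h\<close> is integrable and that the sum of the pieces converges absolutely.\<close>

lemma decays_integral_has_sum:
  fixes h :: "real ^ 'n \<Rightarrow> complex"
  assumes h: "decays h"
  shows "((\<lambda>m. integral (cbox 0 1) (\<lambda>x. h (x + m))) has_sum (LINT x|lborel. h x)) integer_points"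
proof -
  have cont: "continuous_on UNIV h" using h by (simp add: decays_def)
  have [measurable]: "h \<in> borel_measurable borel" using h by (rule decays_borel_measurable)
  have conthm: "continuous_on S (\<lambda>x. h (x + m))" for S m
    by (rule continuous_on_compose2[OF cont]) (auto intro: continuous_intros)
  obtain M where M: "M summable_on integer_points" "\<And>m. 0 \<le> M m"
    "\<And>x m. x \<in> cbox 0 1 \<Longrightarrow> m \<in> integer_points \<Longrightarrow> norm (h (x + m)) \<le> M m"
    by (rule decays_majorant[OF h]) blast
  obtain e :: "nat \<Rightarrow> real ^ 'n" where e: "bij_betw e UNIV integer_points"
    using countableE_infinite[OF countable_integer_points infinite_integer_points]
    by (metis bij_betw_inv_into)
  have e_in: "e i \<in> integer_points" for i using e by (auto simp: bij_betw_def)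
  define A where "A i = {x. x - e i \<in> unit_cell}" for i
  have A_meas [measurable]: "A i \<in> sets borel" for i
    unfolding A_def by measurable
  have A_UN: "(\<Union>i. A i) = UNIV"
  proof -
    have "\<exists>i. x \<in> A i" for x
    proof -
      obtain m where m: "m \<in> integer_points" "x - m \<in> unit_cell"
        by (rule unit_cell_translate_exists)
      then obtain i where "m = e i" using e unfolding bij_betw_def by (metis imageE)
      then show ?thesis using m by (auto simp: A_def)
    qed
    then show ?thesis by auto
  qed
  have A_disj: "A i \<inter> A j = {}" if "i \<noteq> j" for i j
    using that unit_cell_disjoint[OF _ _ e_in e_in] e by (auto simp: A_def bij_betw_def inj_def)
  have A_bound: "norm (h x) \<le> M (e i)" if "x \<in> A i" for x i
    using M(3)[of "x - e i" "e i"] that unit_cell_subset_cbox e_in by (auto simp: A_def)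
  \<comment> \<open>Each cell lies in a translate of the closed unit cube.\<close>
  have A_vol: "emeasure lborel (A i) \<le> 1" for i
  proof -
    have "x \<in> cbox (e i) (e i + 1)" if "x \<in> A i" for x
    proof -
      have "x - e i \<in> cbox 0 1" using that unit_cell_subset_cbox by (auto simp: A_def)
      then show ?thesis by (auto simp: mem_box_cart algebra_simps)
    qed
    then have "emeasure lborel (A i) \<le> emeasure lborel (cbox (e i) (e i + 1))"
      by (intro emeasure_mono) auto
    also have "measure lborel (cbox (e i) (e i + 1)) = 1"
      using content_unit_cube[where 'n='n] measure_translation[of "e i" "cbox 0 1"]
      by (simp add: cbox_translation[symmetric])
    then have "emeasure lborel (cbox (e i) (e i + 1)) = 1"
      using emeasure_eq_ennreal_measure[of lborel "cbox (e i) (e i + 1)"]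
        emeasure_lborel_cbox_finite[of "e i" "e i + 1"] by (simp add: less_top)
    finally show ?thesis .
  qed
  have sumM: "summable (\<lambda>i. M (e i))"
    using M(1) e by (subst (asm) summable_on_reindex_bij_betw[OF e, symmetric]) (rule summable_on_imp_summable)
  have int: "integrable lborel h"
  proof (rule integrableI_bounded)
    have "(\<integral>\<^sup>+x. ennreal (norm (h x)) \<partial>lborel) \<le> (\<integral>\<^sup>+x. (\<Sum>i. ennreal (M (e i)) * indicator (A i) x) \<partial>lborel)"
    proof (rule nn_integral_mono)
      fix x
      obtain i where i: "x \<in> A i" using A_UN by auto
      have "ennreal (norm (h x)) \<le> ennreal (M (e i)) * indicator (A i) x"
        using A_bound[OF i] i by (simp add: ennreal_leI)
      also have "\<dots> = (\<Sum>i\<in>{i}. ennreal (M (e i)) * indicator (A i) x)"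
        by (simp only: finite.emptyI sum.insert empty_iff not_False_eq_True sum.empty add_0_right)
      also have "\<dots> \<le> (\<Sum>i. ennreal (M (e i)) * indicator (A i) x)"
        by (rule sum_le_suminf) auto
      finally show "ennreal (norm (h x)) \<le> (\<Sum>i. ennreal (M (e i)) * indicator (A i) x)" .
    qed
    also have "\<dots> = (\<Sum>i. ennreal (M (e i)) * emeasure lborel (A i))"
      by (subst nn_integral_suminf) (auto simp: nn_integral_cmult_indicator)
    also have "\<dots> \<le> (\<Sum>i. ennreal (M (e i)))"
      using A_vol mult_left_mono[OF A_vol] by (intro suminf_le) (auto simp del: mult_left_mono)
    also have "\<dots> < \<infinity>"
      using sumM M(2) by (simp add: suminf_ennreal2)
    finally show "(\<integral>\<^sup>+x. ennreal (norm (h x)) \<partial>lborel) < \<infinity>" .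
  qed simp
  define I where "I m = integral (cbox 0 1) (\<lambda>x. h (x + m))" for m
  have I_bound: "norm (I m) \<le> M m" if "m \<in> integer_points" for m
  proof -
    have "((\<lambda>x. h (x + m)) has_integral I m) (cbox 0 1)"
      unfolding I_def by (intro integrable_integral integrable_continuous conthm)
    from has_integral_bound[OF M(2) this, of m] M(3) that show ?thesis
      by (simp add: content_unit_cube)
  qed
  have LI: "(LINT x:A i|lborel. h x) = I (e i)" for i
    unfolding A_def I_def by (rule lebesgue_integral_translated_cell[OF cont])
  have "(LINT x|lborel. h x) = (LINT x:(\<Union>i. A i)|lborel. h x)"
    by (simp add: A_UN set_lebesgue_integral_def)
  also have "\<dots> = (\<Sum>i. I (e i))"
    by (subst lebesgue_integral_countable_add) (auto simp: A_disj A_UN set_integrable_def int LI)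
  finally have eq: "(LINT x|lborel. h x) = (\<Sum>i. I (e i))" .
  have sn: "summable (\<lambda>i. norm (I (e i)))"
    by (rule summable_comparison_test[OF _ sumM]) (auto simp: I_bound e_in)
  have "((\<lambda>i. I (e i)) has_sum (\<Sum>i. I (e i))) UNIV"
    by (rule norm_summable_imp_has_sum[OF sn summable_sums[OF summable_norm_cancel[OF sn]]])
  then show ?thesis
    by (simp add: eq I_def[symmetric] has_sum_reindex_bij_betw[OF e])
qed

lemma periodization:
  fixes h :: "real ^ 'n \<Rightarrow> complex"
  assumes h: "decays h"
  shows "continuous_on (cbox 0 1) (\<lambda>x. \<Sum>\<^sub>\<infinity>m\<in>integer_points. h (x + m))"
    and "integral (cbox 0 1) (\<lambda>x. \<Sum>\<^sub>\<infinity>m\<in>integer_points. h (x + m)) = (LINT x|lborel. h x)"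
proof -
  have cont: "continuous_on UNIV h" using h by (simp add: decays_def)
  obtain M where M: "M summable_on integer_points"
    "\<And>x m. x \<in> cbox 0 1 \<Longrightarrow> m \<in> integer_points \<Longrightarrow> norm (h (x + m)) \<le> M m"
    by (rule decays_majorant[OF h]) blast
  have conthm: "continuous_on (cbox 0 1) (\<lambda>x. h (x + m))" for m
    by (rule continuous_on_compose2[OF cont]) (auto intro: continuous_intros)
  have bd: "norm (h (x + m)) \<le> M m" if "m \<in> integer_points" "x \<in> cbox 0 1" for x m
    using M(2) that by blast
  note S = integrate_series[of M integer_points 0 1 "\<lambda>m x. h (x + m)", OF M(1) bd conthm]
  show "continuous_on (cbox 0 1) (\<lambda>x. \<Sum>\<^sub>\<infinity>m\<in>integer_points. h (x + m))" by (rule S(1))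
  show "integral (cbox 0 1) (\<lambda>x. \<Sum>\<^sub>\<infinity>m\<in>integer_points. h (x + m)) = (LINT x|lborel. h x)"
    by (rule has_sum_unique[OF S(2) decays_integral_has_sum[OF h]])
qed

section \<open>Characters and uniqueness of Fourier coefficients\<close>

text \<open>The additive character of the Euclidean space with frequency \<open>k\<close>.\<close>

definition wave :: "real ^ 'n \<Rightarrow> real ^ 'n \<Rightarrow> complex" where
  "wave k x = cis (2 * pi * (k \<bullet> x))"

lemma wave_add: "wave (k + l) x = wave k x * wave l x"
  by (simp add: wave_def cis_mult inner_add_left distrib_left)

lemma wave_add_right: "wave k (x + y) = wave k x * wave k y"
  by (simp add: wave_def cis_mult inner_add_right distrib_left)

lemma wave_0 [simp]: "wave 0 x = 1" "wave k 0 = 1"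
  by (simp_all add: wave_def)

lemma norm_wave [simp]: "norm (wave k x) = 1"
  by (simp add: wave_def)

lemma cnj_wave: "cnj (wave k x) = wave (- k) x"
  by (simp add: wave_def cis_cnj)

lemma wave_integer: "k \<bullet> m \<in> \<int> \<Longrightarrow> wave k m = 1"
  by (simp add: wave_def cis_multiple_2pi)

lemma continuous_on_wave [continuous_intros]: "continuous_on S (wave k)"
  unfolding wave_def by (intro continuous_intros)

lemma lborel_integral_prod_Basis:
  fixes f :: "'a::euclidean_space \<Rightarrow> real \<Rightarrow> complex"
  assumes f: "\<And>b. b \<in> Basis \<Longrightarrow> integrable lborel (f b)"
  shows "(LINT x|lborel. (\<Prod>b\<in>Basis. f b (x \<bullet> b))) = (\<Prod>b\<in>(Basis :: 'a set). LINT t|lborel. f b t)"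
proof -
  interpret product_sigma_finite "\<lambda>_. lborel :: real measure" ..
  have [measurable]: "f b \<in> borel_measurable borel" if "b \<in> Basis" for b
    using f[OF that] by auto
  have D: "lborel = distr (\<Pi>\<^sub>M b\<in>Basis. lborel) borel (\<lambda>f. \<Sum>b\<in>Basis. f b *\<^sub>R b :: 'a)"
    by (subst lborel_def) (simp add: lborel_eq_real)
  have "(LINT x|lborel. (\<Prod>b\<in>Basis. f b (x \<bullet> b)))
      = (LINT x|distr (\<Pi>\<^sub>M b\<in>Basis. lborel) borel (\<lambda>f. \<Sum>b\<in>Basis. f b *\<^sub>R b :: 'a). (\<Prod>b\<in>Basis. f b (x \<bullet> b)))"
    using D by metis
  also have "\<dots> = (LINT x|(\<Pi>\<^sub>M b\<in>(Basis :: 'a set). lborel). (\<Prod>b\<in>Basis. f b (x b)))"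
    by (subst integral_distr) auto
  also have "\<dots> = (\<Prod>b\<in>(Basis :: 'a set). LINT t|lborel. f b t)"
    by (rule product_integral_prod) (auto simp: f)
  finally show ?thesis .
qed

lemma cis_sum: "cis (\<Sum>b\<in>B. a b) = (\<Prod>b\<in>B. cis (a b))"
  by (induction B rule: infinite_finite_induct) (auto simp: cis_mult[symmetric])

lemma integral_cis_period:
  fixes a :: real
  assumes "a \<in> \<int>" "a \<noteq> 0"
  shows "(LINT t|lborel. indicator {0..1} t *\<^sub>R cis (2 * pi * (a * t))) = 0"
proof -
  define F where "F t = cis (2 * pi * (a * t)) / (2 * pi * a * \<i>)" for t
  have "(F has_vector_derivative cis (2 * pi * (a * t))) (at t within {0..1})" for t
    unfolding F_def cis_conv_exp using assms
    by (auto intro!: derivative_eq_intros has_vector_derivative_real_field simp: field_simps)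
  then have "(LINT t|lborel. indicator {0..1} t *\<^sub>R cis (2 * pi * (a * t))) = F 1 - F 0"
    by (intro integral_FTC_Icc) (auto intro!: continuous_intros)
  also have "\<dots> = 0"
    using assms by (simp add: F_def cis_multiple_2pi)
  finally show ?thesis .
qed

text \<open>Orthogonality of the characters. The integrand is a product of functions of one coordinate, and
  the factor of a coordinate with nonzero frequency integrates over a full number of periods.\<close>

lemma integral_wave:
  fixes k :: "real ^ 'n"
  assumes k: "k \<in> integer_points"
  shows "integral (cbox 0 1) (wave k) = (if k = 0 then 1 else 0)"
proof (cases "k = 0")
  case True
  then show ?thesis by (simp add: wave_def[abs_def] content_unit_cube)
next
  case False
  then obtain i where i: "k $ i \<noteq> 0" by (auto simp: vec_eq_iff)
  define g :: "real ^ 'n \<Rightarrow> real \<Rightarrow> complex" where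
    "g b t = indicator {0..1} t *\<^sub>R cis (2 * pi * ((k \<bullet> b) * t))" for b t
  have int: "integrable lborel (g b)" for b
    unfolding g_def by (rule borel_integrable_compact) (auto intro!: continuous_intros)
  have eq: "indicator (cbox 0 1) x *\<^sub>R wave k x = (\<Prod>b\<in>Basis. g b (x \<bullet> b))" for x
  proof -
    have "wave k x = (\<Prod>b\<in>Basis. cis (2 * pi * ((k \<bullet> b) * (x \<bullet> b))))"
      unfolding wave_def by (subst euclidean_inner) (simp add: sum_distrib_left cis_sum)
    moreover have "indicator (cbox 0 1) x = (\<Prod>b\<in>(Basis :: (real ^ 'n) set). indicator {0..1} (x \<bullet> b) :: real)"
    proof (cases "x \<in> cbox 0 1")
      case True
      then show ?thesis by (auto simp: mem_box one_vec_eq_One)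
    next
      case False
      then obtain b :: "real ^ 'n" where "b \<in> Basis" "x \<bullet> b \<notin> {0..1}"
        by (auto simp: mem_box one_vec_eq_One)
      then have "(\<Prod>b\<in>(Basis :: (real ^ 'n) set). indicator {0..1} (x \<bullet> b) :: real) = 0"
        by (auto intro!: prod_zero bexI[of _ b])
      then show ?thesis using False by simp
    qed
    ultimately show ?thesis
      by (simp add: g_def scaleR_conv_of_real prod.distrib)
  qed
  have "integral (cbox 0 1) (wave k) = (LINT x:cbox 0 1|lborel. wave k x)"
    by (rule set_borel_integral_eq_integral(2)[symmetric])
      (auto simp: set_integrable_def intro!: borel_integrable_compact continuous_intros)
  also have "\<dots> = (\<Prod>b\<in>Basis. LINT t|lborel. g b t)"
    unfolding set_lebesgue_integral_def eq by (rule lborel_integral_prod_Basis[OF int])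
  also have "\<dots> = 0"
  proof (rule prod_zero)
    have "k \<bullet> axis i 1 \<in> \<int>" "k \<bullet> axis i 1 \<noteq> 0"
      using k i by (auto simp: integer_points_def inner_axis)
    then have "(LINT t|lborel. g (axis i 1) t) = 0"
      unfolding g_def by (rule integral_cis_period)
    then show "\<exists>b\<in>Basis. (LINT t|lborel. g b t) = 0"
      by (intro bexI[of _ "axis i 1"]) (auto simp: axis_in_Basis_iff)
  qed simp
  finally show ?thesis using False by simp
qed

text \<open>The functions on the cube that are orthogonal to every character. The aim is that a periodic one
  vanishes.\<close>

definition null_fourier :: "(real ^ 'n \<Rightarrow> complex) \<Rightarrow> bool" where
  "null_fourier H \<longleftrightarrow> continuous_on (cbox 0 1) H \<and>
    (\<forall>k\<in>integer_points. integral (cbox 0 1) (\<lambda>x. H x * wave k x) = 0)"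

lemma null_fourier_integrable:
  "null_fourier H \<Longrightarrow> (\<lambda>x. H x * wave k x) integrable_on cbox 0 1"
  by (rule integrable_continuous) (auto simp: null_fourier_def intro!: continuous_intros)

lemma null_fourier_has_integral:
  assumes "null_fourier H"
  shows "(H has_integral 0) (cbox 0 1)"
proof -
  have "integral (cbox 0 1) (\<lambda>x. H x * wave 0 x) = 0"
    using assms integer_points_closed(1) unfolding null_fourier_def by blast
  then show ?thesis
    using integrable_integral[OF null_fourier_integrable[OF assms, of 0]] by simp
qed

lemma null_fourier_add:
  assumes "null_fourier G" "null_fourier H"
  shows "null_fourier (\<lambda>x. G x + H x)"
  using assms null_fourier_integrable[OF assms(1)] null_fourier_integrable[OF assms(2)]
  unfolding null_fourier_def
  by (auto intro!: continuous_on_add simp: distrib_right Henstock_Kurzweil_Integration.integral_add)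

lemma null_fourier_cmult:
  assumes "null_fourier H"
  shows "null_fourier (\<lambda>x. c * H x)"
  using assms unfolding null_fourier_def
  by (auto intro!: continuous_on_mult continuous_on_const simp: mult.assoc)

lemma null_fourier_sum:
  "finite B \<Longrightarrow> (\<And>b. b \<in> B \<Longrightarrow> null_fourier (H b)) \<Longrightarrow> null_fourier (\<lambda>x. \<Sum>b\<in>B. H b x)"
proof (induction B rule: finite_induct)
  case empty
  then show ?case by (simp add: null_fourier_def)
next
  case (insert b B)
  then show ?case by (simp add: null_fourier_add)
qed

lemma null_fourier_wave:
  assumes "null_fourier H" "l \<in> integer_points"
  shows "null_fourier (\<lambda>x. H x * wave l x)"
proof -
  have "integral (cbox 0 1) (\<lambda>x. H x * wave l x * wave k x) = 0" if "k \<in> integer_points" for k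
  proof -
    have "integral (cbox 0 1) (\<lambda>x. H x * wave (l + k) x) = 0"
      using assms that unfolding null_fourier_def by simp
    then show ?thesis by (simp add: wave_add mult.assoc)
  qed
  then show ?thesis
    using assms(1) unfolding null_fourier_def by (auto intro!: continuous_on_mult continuous_on_wave)
qed

text \<open>The torus realized inside a Euclidean space, where the Stone-Weierstrass theorem can be
  applied to the polynomials in the real and imaginary parts of the coordinates.\<close>

definition torus_map :: "real ^ 'n \<Rightarrow> complex ^ 'n" where
  "torus_map x = (\<chi> i. cis (2 * pi * x $ i))"

lemma continuous_on_torus_map: "continuous_on S torus_map"
  unfolding torus_map_def by (intro continuous_intros)

text \<open>The functions with vanishing Fourier coefficients form a module over the polynomials on the torus:
  multiplication by a coordinate is a combination of multiplications by two characters, which only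
  shift the Fourier coefficients. The induction needs the statement for all \<open>H\<close> at once, because the product case
  applies one factor to the result of the other.\<close>

lemma null_fourier_polynomial:
  fixes H :: "real ^ 'n \<Rightarrow> complex"
  assumes "real_polynomial_function p" "null_fourier H"
  shows "null_fourier (\<lambda>x. H x * of_real (p (torus_map x)))"
  using assms
proof (induction arbitrary: H rule: real_polynomial_function.induct)
  case (linear p)
  then have lin: "linear p" by (simp add: bounded_linear.linear)
  have coord: "null_fourier (\<lambda>x. H x * of_real (torus_map x \<bullet> b))" if bB: "b \<in> Basis" for b :: "complex ^ 'n"
  proof -
    obtain i u where b: "b = axis i u" using bB by (auto simp: Basis_vec_def)
    have "H x * of_real (torus_map x \<bullet> b)
        = (cnj u / 2) * (H x * wave (axis i 1) x) + (u / 2) * (H x * wave (- axis i 1) x)" for x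
    proof -
      have w: "torus_map x $ i = wave (axis i 1) x"
        by (simp add: torus_map_def wave_def inner_axis' )
      \<comment> \<open>The same formula covers the real and the imaginary coordinate, as \<open>u\<close> is \<open>1\<close> or \<open>\<i>\<close>.\<close>
      have "complex_of_real (z \<bullet> u) = (cnj u * z + u * cnj z) / 2" for z
        by (simp add: complex_eq_iff inner_complex_def)
      then show ?thesis
        unfolding b inner_axis w cnj_wave[symmetric] by (simp add: field_simps)
    qed
    then show ?thesis
      using null_fourier_wave[OF linear(2)]
      by (auto intro!: null_fourier_add null_fourier_cmult simp del: times_divide_eq_left)
  qed
  have expand: "p z = (\<Sum>b\<in>Basis. (z \<bullet> b) * p b)" for z
    using euclidean_representation[of z] linear_sum[OF lin, of "\<lambda>b. (z \<bullet> b) *\<^sub>R b" Basis]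
    by (simp add: linear_scale[OF lin])
  have "H x * of_real (p (torus_map x)) = (\<Sum>b\<in>Basis. of_real (p b) * (H x * of_real (torus_map x \<bullet> b)))" for x
    by (subst expand) (simp add: sum_distrib_left mult_ac)
  then show ?case
    using coord by (simp only:) (intro null_fourier_sum null_fourier_cmult; simp)
next
  case (const c)
  then show ?case using null_fourier_cmult[of H "of_real c"] by (simp add: mult.commute)
next
  case (add p q)
  then show ?case
    using null_fourier_add[OF add.IH(1)[OF add.prems] add.IH(2)[OF add.prems]] by (simp add: distrib_left)
next
  case (mult p q)
  then show ?case by (simp add: mult.assoc[symmetric])
qed

lemma torus_map_eq_imp:
  assumes "torus_map x = torus_map y"
  shows "x - y \<in> integer_points"
proof -
  have "x $ i - y $ i \<in> \<int>" for i
  proof -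
    have "cis (2 * pi * x $ i) = cis (2 * pi * y $ i)"
      using assms by (auto simp: torus_map_def vec_eq_iff)
    then have "cis (2 * pi * x $ i - 2 * pi * y $ i) = 1"
      by (simp add: cis_divide[symmetric])
    then have "cos (2 * pi * (x $ i - y $ i)) = 1"
      by (simp add: complex_eq_iff right_diff_distrib)
    then obtain n :: int where "2 * pi * (x $ i - y $ i) = real_of_int n * 2 * pi"
      using cos_one_2pi_int by auto
    then have "x $ i - y $ i = n" by simp
    then show ?thesis by simp
  qed
  then show ?thesis by (simp add: integer_points_def)
qed

text \<open>A periodic function factors through the torus. Continuity of the factor holds because a continuous
  map on the compact cube sends closed sets to closed sets, so the cube carries the quotient
  topology to the torus.\<close>

lemma descend_to_torus:
  fixes H :: "real ^ 'a \<Rightarrow> 'b::topological_space"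
  assumes cont: "continuous_on (cbox 0 1) H"
    and per: "\<And>x m. m \<in> integer_points \<Longrightarrow> H (x + m) = H x"
  obtains h where "continuous_on (torus_map ` cbox 0 1) h" "\<And>x. x \<in> cbox 0 1 \<Longrightarrow> h (torus_map x) = H x"
proof -
  define h where "h z = H (SOME x. x \<in> cbox 0 1 \<and> torus_map x = z)" for z
  have h: "h (torus_map x) = H x" if "x \<in> cbox 0 1" for x
  proof -
    define y where "y = (SOME y. y \<in> cbox 0 1 \<and> torus_map y = torus_map x)"
    have "y \<in> cbox 0 1 \<and> torus_map y = torus_map x"
      unfolding y_def by (rule someI[of _ x]) (use that in simp)
    then have "H (x + (y - x)) = H x" by (intro per torus_map_eq_imp) simp
    then show ?thesis by (simp add: h_def y_def)
  qed
  have compact: "compact (torus_map ` C)" if "compact C" for C :: "(real ^ 'a) set"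
    using that by (intro compact_continuous_image continuous_on_torus_map)
  have "continuous_on (torus_map ` cbox 0 1) h"
  proof (subst continuous_on_closed_vimage)
    show "closed (torus_map ` cbox 0 (1 :: real ^ 'a))"
      by (intro compact_imp_closed compact) simp
    show "\<forall>B. closed B \<longrightarrow> closed (h -` B \<inter> torus_map ` cbox 0 1)"
    proof (intro allI impI)
      fix B :: "'b set" assume "closed B"
      then have "closed (H -` B \<inter> cbox 0 1)"
        using cont continuous_on_closed_vimage[of "cbox 0 1" H] by auto
      moreover have "H -` B \<inter> cbox 0 1 = (H -` B \<inter> cbox 0 1) \<inter> cbox 0 1" by blast
      ultimately have "compact (H -` B \<inter> cbox 0 1)"
        by (metis closed_Int_compact compact_cbox)
      then have "closed (torus_map ` (H -` B \<inter> cbox 0 1))"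
        using compact compact_imp_closed by metis
      moreover have "torus_map ` (H -` B \<inter> cbox 0 1) = h -` B \<inter> torus_map ` cbox 0 1"
        using h by auto
      ultimately show "closed (h -` B \<inter> torus_map ` cbox 0 1)" by simp
    qed
  qed
  with h show thesis using that by blast
qed

text \<open>Polynomials are uniformly dense among the continuous real functions on the compact torus.\<close>

lemma null_fourier_orthogonal:
  assumes H: "null_fourier H" and r: "continuous_on (torus_map ` cbox 0 1) r"
  shows "integral (cbox 0 1) (\<lambda>x. H x * of_real (r (torus_map x))) = 0"
proof -
  have contH: "continuous_on (cbox 0 1) H" using H by (simp add: null_fourier_def)
  have contr: "continuous_on (cbox 0 1) (\<lambda>x. r (torus_map x))"
    by (rule continuous_on_compose2[OF r continuous_on_torus_map]) auto
  have "bounded (H ` cbox 0 1)"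
    using contH by (intro compact_imp_bounded compact_continuous_image) auto
  then obtain B where B: "B > 0" "\<And>x. x \<in> cbox 0 1 \<Longrightarrow> norm (H x) \<le> B"
    by (auto simp: bounded_pos)
  let ?I = "integral (cbox 0 1) (\<lambda>x. H x * of_real (r (torus_map x)))"
  have "norm ?I \<le> 0 + e" if "e > 0" for e
  proof -
    have "compact (torus_map ` cbox 0 (1 :: real ^ 'a))"
      by (intro compact_continuous_image continuous_on_torus_map) simp
    then obtain p where p: "real_polynomial_function p"
      "\<And>z. z \<in> torus_map ` cbox 0 1 \<Longrightarrow> \<bar>r z - p z\<bar> < e / B"
      using Stone_Weierstrass_real_polynomial_function[OF _ r, of "e / B"] \<open>e > 0\<close> B(1) by auto
    have N: "null_fourier (\<lambda>x. H x * of_real (p (torus_map x)))"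
      using p(1) H by (rule null_fourier_polynomial)
    then have 0: "((\<lambda>x. H x * of_real (p (torus_map x))) has_integral 0) (cbox 0 1)"
      by (rule null_fourier_has_integral)
    have "((\<lambda>x. H x * of_real (r (torus_map x))) has_integral ?I) (cbox 0 1)"
      by (intro integrable_integral integrable_continuous continuous_intros contH contr)
    from has_integral_diff[OF this 0]
    have "((\<lambda>x. H x * of_real (r (torus_map x) - p (torus_map x))) has_integral ?I) (cbox 0 1)"
      by (simp add: right_diff_distrib)
    then have "norm ?I \<le> e * measure lborel (cbox 0 (1 :: real ^ 'a))"
    proof (rule has_integral_bound[rotated])
      fix x :: "real ^ 'a" assume x: "x \<in> cbox 0 1"
      have "norm (H x) * \<bar>r (torus_map x) - p (torus_map x)\<bar> \<le> B * (e / B)"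
        using B x p(2)[of "torus_map x"] by (intro mult_mono) (auto intro: less_imp_le)
      then show "norm (H x * of_real (r (torus_map x) - p (torus_map x))) \<le> e"
        using B(1) by (simp add: norm_mult del: of_real_diff)
    qed (use \<open>e > 0\<close> in simp)
    then show ?thesis by (simp add: content_unit_cube)
  qed
  then have "norm ?I \<le> 0" by (rule field_le_epsilon)
  then show ?thesis by simp
qed

text \<open>Taking the real and the imaginary part of \<open>H\<close> itself as test functions shows
  that the square of its norm has integral zero over the cube. By continuity \<open>H\<close> vanishes there, and by
  periodicity everywhere.\<close>

lemma fourier_uniqueness:
  fixes H :: "real ^ 'n \<Rightarrow> complex"
  assumes H: "null_fourier H" and per: "\<And>x m. m \<in> integer_points \<Longrightarrow> H (x + m) = H x"
  shows "H x = 0"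
proof -
  have contH: "continuous_on (cbox 0 1) H" using H by (simp add: null_fourier_def)
  obtain h where h: "continuous_on (torus_map ` cbox 0 1) h" "\<And>x. x \<in> cbox 0 1 \<Longrightarrow> h (torus_map x) = H x"
    using descend_to_torus[OF contH per] by blast
  have orth: "((\<lambda>x. H x * of_real (r (H x))) has_integral 0) (cbox 0 1)"
    if r: "continuous_on UNIV r" for r :: "complex \<Rightarrow> real"
  proof -
    have "continuous_on (torus_map ` cbox 0 1) (\<lambda>z. r (h z))"
      by (rule continuous_on_compose2[OF r h(1)]) auto
    from null_fourier_orthogonal[OF H this]
    have "integral (cbox 0 1) (\<lambda>x. H x * of_real (r (H x))) = 0"
      using h(2) by (subst integral_cong[where g="\<lambda>x. H x * of_real (r (h (torus_map x)))"]) auto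
    moreover have "((\<lambda>x. H x * of_real (r (H x))) has_integral integral (cbox 0 1) (\<lambda>x. H x * of_real (r (H x)))) (cbox 0 1)"
      by (intro integrable_integral integrable_continuous continuous_intros contH
          continuous_on_compose2[OF r contH]) auto
    ultimately show ?thesis by simp
  qed
  note ReIm = orth[of Re, OF continuous_on_Re[OF continuous_on_id]]
    orth[of Im, OF continuous_on_Im[OF continuous_on_id]]
  \<comment> \<open>The conjugate of \<open>H\<close> is its real part minus \<open>\<i>\<close> times its imaginary part.\<close>
  have "((\<lambda>x. Re (H x * of_real (Re (H x)) + (- \<i>) * (H x * of_real (Im (H x))))) has_integral Re (0 + (- \<i>) * 0)) (cbox 0 1)"
    using has_integral_linear[OF has_integral_add[OF ReIm(1) has_integral_mult_right[OF ReIm(2), of "- \<i>"]] bounded_linear_Re]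
    by (simp add: o_def)
  then have sq: "((\<lambda>x. (norm (H x))\<^sup>2) has_integral 0) (cbox 0 1)"
    unfolding cmod_power2 by (simp add: power2_eq_square)
  have zero: "(norm (H y))\<^sup>2 = 0" if "y \<in> cbox 0 1" for y
  proof (rule has_integral_0_cbox_imp_0[OF _ _ sq _ that])
    show "continuous_on (cbox 0 1) (\<lambda>x. (norm (H x))\<^sup>2)"
      by (intro continuous_intros contH)
    show "box 0 (1 :: real ^ 'n) \<noteq> {}"
      by (simp add: one_vec_eq_One box_ne_empty)
  qed simp
  obtain m where m: "m \<in> integer_points" "x - m \<in> unit_cell"
    by (rule unit_cell_translate_exists)
  have "H ((x - m) + m) = H (x - m)"
    by (rule per[OF m(1)])
  moreover have "x - m \<in> cbox 0 1"
    using m(2) unit_cell_subset_cbox by blast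
  ultimately show ?thesis using zero[of "x - m"] by simp
qed

section \<open>Poisson summation\<close>

text \<open>The Fourier transform for complex functions: the shift of a transform by \<open>v\<close> is the transform of the
  function times a character, which is no longer real.\<close>

definition cfourier :: "(real ^ 'n \<Rightarrow> complex) \<Rightarrow> real ^ 'n \<Rightarrow> complex" where
  "cfourier h k = (LINT r|lborel. h r * wave (- k) r)"

lemma decays_wave: "decays h \<Longrightarrow> decays (\<lambda>x. h x * wave k x)"
  by (rule decays_mult_unimodular) (auto intro: continuous_intros)

text \<open>Poisson summation for the integer points. The periodization of \<open>g\<close> and the
  Fourier series on the right are both continuous and periodic; unfolding for the first and
  orthogonality for the second show that they have the same Fourier coefficients.\<close>

lemma poisson_integer_points:
  fixes g :: "real ^ 'n \<Rightarrow> complex"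
  assumes g: "decays g" and sm: "(\<lambda>k. norm (cfourier g k)) summable_on integer_points"
  shows "(\<Sum>\<^sub>\<infinity>m\<in>integer_points. g (x + m)) = (\<Sum>\<^sub>\<infinity>k\<in>integer_points. cfourier g k * wave k x)"
proof -
  define F where "F x = (\<Sum>\<^sub>\<infinity>m\<in>integer_points. g (x + m))" for x
  define S where "S x = (\<Sum>\<^sub>\<infinity>k\<in>integer_points. cfourier g k * wave k x)" for x
  have F_per: "F (x + a) = F x" if a: "a \<in> integer_points" for x a
    using infsum_reindex_bij_betw[OF bij_betw_add_integer_points[OF a], of "\<lambda>m. g (x + m)"]
    by (simp add: F_def add.assoc)
  have S_per: "S (x + a) = S x" if "a \<in> integer_points" for x a
    unfolding S_def
    by (intro infsum_cong) (simp add: wave_add_right wave_integer inner_integer_points that)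
  have contF: "continuous_on (cbox 0 1) F"
    unfolding F_def by (rule periodization[OF g])
  have contS: "continuous_on (cbox 0 1) S"
    unfolding S_def
    by (rule integrate_series(1)[OF sm]) (auto simp: norm_mult intro!: continuous_intros)
  have F_int: "integral (cbox 0 1) (\<lambda>x. F x * wave k x) = cfourier g (- k)" if k: "k \<in> integer_points" for k
  proof -
    have "F x * wave k x = (\<Sum>\<^sub>\<infinity>m\<in>integer_points. g (x + m) * wave k (x + m))" for x
      unfolding F_def infsum_cmult_left'[symmetric]
      by (intro infsum_cong) (simp add: wave_add_right wave_integer inner_integer_points k)
    then show ?thesis
      using periodization(2)[OF decays_wave[OF g]] by (simp add: cfourier_def)
  qed
  have S_int: "integral (cbox 0 1) (\<lambda>x. S x * wave l x) = cfourier g (- l)" if l: "l \<in> integer_points" for l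
  proof -
    have eq: "S x * wave l x = (\<Sum>\<^sub>\<infinity>k\<in>integer_points. cfourier g k * wave (k + l) x)" for x
      unfolding S_def infsum_cmult_left'[symmetric] by (simp add: wave_add mult.assoc)
    \<comment> \<open>The same family is summed twice: termwise integration of the series, and orthogonality.\<close>
    have "((\<lambda>k. integral (cbox 0 1) (\<lambda>x. cfourier g k * wave (k + l) x)) has_sum
        integral (cbox 0 1) (\<lambda>x. S x * wave l x)) integer_points"
      unfolding eq
      by (rule integrate_series(2)[OF sm]) (auto simp: norm_mult intro!: continuous_intros)
    moreover have "((\<lambda>k. integral (cbox 0 1) (\<lambda>x. cfourier g k * wave (k + l) x)) has_sum cfourier g (- l)) integer_points"
    proof (rule has_sum_finite_neutralI[where B = "{- l}"])
      show "{- l} \<subseteq> integer_points" using l by simp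
      show "integral (cbox 0 1) (\<lambda>x. cfourier g k * wave (k + l) x) = 0" if "k \<in> integer_points - {- l}" for k
        using that l integral_wave[of "k + l"] by (auto simp: add_eq_0_iff2)
      show "cfourier g (- l) = (\<Sum>k\<in>{- l}. integral (cbox 0 1) (\<lambda>x. cfourier g k * wave (k + l) x))"
        by (simp add: content_unit_cube)
    qed simp
    ultimately show ?thesis using has_sum_unique by blast
  qed
  have "null_fourier (\<lambda>x. F x - S x)"
    unfolding null_fourier_def
  proof (intro conjI ballI)
    show "continuous_on (cbox 0 1) (\<lambda>x. F x - S x)" by (intro continuous_intros contF contS)
    fix k :: "real ^ 'n" assume k: "k \<in> integer_points"
    have "(\<lambda>x. F x * wave k x) integrable_on cbox 0 1" "(\<lambda>x. S x * wave k x) integrable_on cbox 0 1"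
      by (intro integrable_continuous continuous_on_mult continuous_on_wave contF contS)+
    then show "integral (cbox 0 1) (\<lambda>x. (F x - S x) * wave k x) = 0"
      by (simp add: left_diff_distrib Henstock_Kurzweil_Integration.integral_diff F_int S_int k)
  qed
  then have "F x - S x = 0" by (rule fourier_uniqueness) (simp add: F_per S_per)
  then show ?thesis by (simp add: F_def S_def)
qed

text \<open>A lattice is the image of the integer points under the linear map \<open>A\<close> that sends the standard basis to
  the given basis, and the dual lattice is their image under the inverse \<open>B\<close> of the adjoint of \<open>A\<close>.\<close>

lemma lattice_parametrization:
  fixes L :: "(real ^ 'n) set"
  assumes "is_lattice L"
  obtains A B :: "real ^ 'n \<Rightarrow> real ^ 'n"
  where "linear A" "bij A" "linear B" "bij B" "L = A ` integer_points" "dual_lattice L = B ` integer_points"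
    "\<And>x y. B x \<bullet> A y = x \<bullet> y"
proof -
  obtain Bs where Bs: "independent Bs" "span Bs = UNIV"
    and L: "L = range (\<lambda>c :: real ^ 'n \<Rightarrow> int. \<Sum>b\<in>Bs. of_int (c b) *\<^sub>R b)"
    using assms by (auto simp: is_lattice_def)
  have "finite Bs" using Bs(1) independent_bound by blast
  have "card Bs = CARD('n)"
    using dim_eq_card[of Bs UNIV] Bs by simp
  then obtain \<beta> where \<beta>: "bij_betw \<beta> (UNIV :: 'n set) Bs"
    using finite_same_card_bij[of "UNIV :: 'n set" Bs] \<open>finite Bs\<close> by auto
  define A where "A x = (\<Sum>i\<in>UNIV. (x $ i) *\<^sub>R \<beta> i)" for x :: "real ^ 'n"
  have reindex: "(\<Sum>b\<in>Bs. u b *\<^sub>R b) = A (\<chi> i. u (\<beta> i))" for u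
    unfolding A_def using sum.reindex_bij_betw[OF \<beta>, of "\<lambda>b. u b *\<^sub>R b"] by simp
  have A: "linear A"
    unfolding A_def by (rule linearI) (simp_all add: scaleR_add_left sum.distrib scaleR_sum_right)
  have "surj A"
  proof -
    have "y \<in> range A" for y
    proof -
      have "y \<in> range (\<lambda>u. \<Sum>b\<in>Bs. u b *\<^sub>R b)"
        using Bs(2) span_finite[OF \<open>finite Bs\<close>] by auto
      then show ?thesis by (auto simp: reindex)
    qed
    then show ?thesis by auto
  qed
  then have bijA: "bij A" using linear_surjective_imp_injective[OF A] by (simp add: bij_def)
  have LA: "L = A ` integer_points"
  proof
    show "L \<subseteq> A ` integer_points"
      unfolding L reindex by (auto simp: integer_points_def)
    show "A ` integer_points \<subseteq> L"
    proof
      fix y assume "y \<in> A ` integer_points"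
      then obtain m where m: "m \<in> integer_points" "y = A m" by auto
      define c where "c b = \<lfloor>m $ (inv_into UNIV \<beta> b)\<rfloor>" for b
      have "of_int (c (\<beta> i)) = m $ i" for i
        using m(1) \<beta> by (auto simp: c_def bij_betw_def integer_points_def)
      then have "y = (\<Sum>b\<in>Bs. of_int (c b) *\<^sub>R b)"
        unfolding reindex m(2) by (simp add: vec_lambda_eta)
      then show "y \<in> L" unfolding L by blast
    qed
  qed
  let ?A = "adjoint A"
  have linA': "linear ?A" using A by (rule adjoint_linear)
  have "inj ?A"
  proof (subst linear_injective_0[OF linA'], intro allI impI)
    fix y assume "?A y = 0"
    then have "y \<bullet> A x = 0" for x using adjoint_works[OF A, of x y] by (simp add: inner_commute)
    moreover obtain x where "y = A x" using \<open>surj A\<close> by (rule surjE)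
    ultimately have "y \<bullet> y = 0" by metis
    then show "y = 0" by simp
  qed
  then have bijA': "bij ?A" using linear_injective_imp_surjective[OF linA'] by (simp add: bij_def)
  define B where "B = inv ?A"
  have AB: "?A (B x) = x" and BA: "B (?A x) = x" for x
    using bijA' by (auto simp: B_def bij_is_surj surj_f_inv_f bij_is_inj)
  have linB: "linear B" unfolding B_def using linA' bijA' by (simp add: bij_is_inj inj_linear_imp_inv_linear)
  have bijB: "bij B" unfolding B_def using bijA' by (rule bij_imp_bij_inv)
  have pairing: "B x \<bullet> A y = x \<bullet> y" for x y
    using adjoint_works[OF A, of y "B x"] by (simp add: AB inner_commute)
  have "x \<in> dual_lattice L \<longleftrightarrow> ?A x \<in> integer_points" for x
  proof
    assume x: "x \<in> dual_lattice L"
    have "?A x $ i \<in> \<int>" for i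
    proof -
      have "x \<bullet> A (axis i 1) \<in> \<int>" using x by (auto simp: dual_lattice_def LA)
      then show ?thesis using pairing[of "?A x" "axis i 1"] by (simp add: BA inner_axis)
    qed
    then show "?A x \<in> integer_points" by (simp add: integer_points_def)
  next
    assume "?A x \<in> integer_points"
    then have "?A x \<bullet> m \<in> \<int>" if "m \<in> integer_points" for m
      using that by (rule inner_integer_points)
    then show "x \<in> dual_lattice L"
      using pairing[of "?A x"] by (auto simp: dual_lattice_def LA BA)
  qed
  then have "dual_lattice L = B ` integer_points"
    by (force simp: AB BA image_iff intro: BA[symmetric])
  with A bijA linB bijB LA pairing show thesis using that by blast
qed

lemma decays_summable_on_lattice:
  fixes h :: "real ^ 'n \<Rightarrow> complex"
  assumes h: "decays h" and L: "is_lattice L"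
  shows "(\<lambda>l. norm (h (l + v))) summable_on L"
proof -
  obtain A :: "real ^ 'n \<Rightarrow> real ^ 'n" where A: "linear A" "bij A" "L = A ` integer_points"
    by (rule lattice_parametrization[OF L])
  define x where "x = inv A v"
  have Ax: "A x = v" using A(2) by (simp add: x_def bij_is_surj surj_f_inv_f)
  obtain a where a: "a \<in> integer_points" and "x - a \<in> unit_cell"
    by (rule unit_cell_translate_exists)
  then have xa: "x - a \<in> cbox 0 1"
    using unit_cell_subset_cbox by blast
  obtain M where M: "M summable_on integer_points"
    "\<And>y m. y \<in> cbox 0 1 \<Longrightarrow> m \<in> integer_points \<Longrightarrow> norm (h (A (y + m))) \<le> M m"
    by (rule decays_majorant[OF decays_comp_linear[OF h A(1,2)]]) blast
  have "(\<lambda>m. norm (h (A ((x - a) + m)))) summable_on integer_points"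
    by (rule summable_on_comparison_test[OF M(1)]) (auto intro: M(2) xa)
  then have "(\<lambda>m. norm (h (A ((x - a) + (a + m))))) summable_on integer_points"
    using summable_on_reindex_bij_betw[OF bij_betw_add_integer_points[OF a], of "\<lambda>m. norm (h (A ((x - a) + m)))"] by simp
  then have "(\<lambda>m. norm (h (A m + v))) summable_on integer_points"
    using linear_add[OF A(1)] Ax by (simp add: add.commute)
  then show ?thesis
    unfolding A(3) using A(2) by (subst summable_on_reindex) (auto simp: bij_def o_def intro: inj_on_subset)
qed

text \<open>Composing \<open>h\<close> with the parametrization of the lattice reduces to the integer points; the
  pairing between the two parametrizations turns characters of integer points into characters of the dual
  lattice. The constant \<open>D\<close> is the inverse covolume. It is obtained once for all \<open>h\<close> and \<open>v\<close>, so that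
  two applications of the formula can be compared.\<close>

lemma poisson_lattice:
  fixes L :: "(real ^ 'n) set"
  assumes L: "is_lattice L"
  obtains D where "D > 0"
    "\<And>h v. decays h \<Longrightarrow> (\<lambda>k. norm (cfourier h k)) summable_on dual_lattice L \<Longrightarrow>
      (\<Sum>\<^sub>\<infinity>l\<in>L. h (l + v)) = complex_of_real D * (\<Sum>\<^sub>\<infinity>k\<in>dual_lattice L. cfourier h k * wave k v)"
proof -
  obtain A B :: "real ^ 'n \<Rightarrow> real ^ 'n" where A: "linear A" "bij A" and B: "linear B" "bij B"
    and LA: "L = A ` integer_points" and dual: "dual_lattice L = B ` integer_points"
    and pairing: "\<And>x y. B x \<bullet> A y = x \<bullet> y"
    by (rule lattice_parametrization[OF L]) (rule that)
  obtain D where D: "D > 0" and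
    subst: "\<And>h :: real ^ 'n \<Rightarrow> complex. h \<in> borel_measurable borel \<Longrightarrow> (LINT x|lborel. h (A x)) = complex_of_real D * (LINT x|lborel. h x)"
    by (rule lebesgue_integral_linear_bij[OF A]) blast
  have injA: "inj_on A S" and injB: "inj_on B S" for S
    using A(2) B(2) by (auto simp: bij_def intro: inj_on_subset)
  have wave_pair: "wave (B k) (A x) = wave k x" for k x
    by (simp add: wave_def pairing)
  have main: "(\<Sum>\<^sub>\<infinity>l\<in>L. h (l + v)) = complex_of_real D * (\<Sum>\<^sub>\<infinity>k\<in>dual_lattice L. cfourier h k * wave k v)"
    if h: "decays h" and sm: "(\<lambda>k. norm (cfourier h k)) summable_on dual_lattice L" for h v
  proof -
    define x where "x = inv A v"
    have Ax: "A x = v" using A(2) by (simp add: x_def bij_is_surj surj_f_inv_f)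
    define g where "g y = h (A y)" for y
    have g: "decays g" unfolding g_def by (rule decays_comp_linear[OF h A])
    have fg: "cfourier g k = complex_of_real D * cfourier h (B k)" for k
    proof -
      have "cfourier g k = (LINT r|lborel. h (A r) * wave (- B k) (A r))"
        unfolding cfourier_def g_def using wave_pair[of "- k"] by (simp add: linear_neg[OF B(1)])
      also have "\<dots> = complex_of_real D * (LINT r|lborel. h r * wave (- B k) r)"
        by (rule subst) (rule decays_borel_measurable[OF decays_wave[OF h]])
      finally show ?thesis by (simp add: cfourier_def)
    qed
    have "(\<lambda>k. norm (cfourier h (B k))) summable_on integer_points"
      using sm unfolding dual by (subst (asm) summable_on_reindex[OF injB]) (simp add: o_def)
    then have "(\<lambda>k. norm (cfourier g k)) summable_on integer_points"
      unfolding fg norm_mult by (rule summable_on_cmult_right)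
    note P = poisson_integer_points[OF g this, of x]
    have "(\<Sum>\<^sub>\<infinity>l\<in>L. h (l + v)) = (\<Sum>\<^sub>\<infinity>m\<in>integer_points. g (x + m))"
      unfolding LA
      by (subst infsum_reindex[OF injA]) (simp add: o_def g_def linear_add[OF A(1)] Ax add.commute)
    also have "\<dots> = (\<Sum>\<^sub>\<infinity>k\<in>integer_points. complex_of_real D * (cfourier h (B k) * wave (B k) v))"
      unfolding P Ax[symmetric] wave_pair by (simp add: fg mult.assoc)
    also have "\<dots> = complex_of_real D * (\<Sum>\<^sub>\<infinity>k\<in>dual_lattice L. cfourier h k * wave k v)"
      unfolding dual by (subst infsum_reindex[OF injB]) (simp add: o_def infsum_cmult_right')
    finally show ?thesis .
  qed
  show thesis by (rule that[OF D main])
qed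

section \<open>Transforms of scaled and modulated functions\<close>

lemma fourier_eq_cfourier: "fourier f x = cfourier (\<lambda>r. complex_of_real (f r)) x"
  unfolding fourier_def cfourier_def wave_def cis_conv_exp
  by (simp add: inner_commute mult_ac)

text \<open>Multiplication by a character shifts the transform. This is what makes the sum of the shifted
  transform accessible to Poisson summation at the origin.\<close>

lemma cfourier_wave_shift:
  "cfourier (\<lambda>r. h r * wave (- v) r) k = cfourier h (k + v)"
proof -
  have "wave (- (k + v)) r = wave (- v) r * wave (- k) r" for r
    using wave_add[of "- k" "- v" r] by (simp add: mult.commute)
  then show ?thesis by (simp add: cfourier_def mult.assoc)
qed

lemma decays_scale:
  fixes h :: "real ^ 'n \<Rightarrow> complex"
  assumes h: "decays h" and t: "t > 0"
  shows "decays (\<lambda>r. h (r /\<^sub>R t))"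
proof (rule decays_comp_linear[OF h])
  show "linear (\<lambda>r :: real ^ 'n. r /\<^sub>R t)" "bij (\<lambda>r :: real ^ 'n. r /\<^sub>R t)"
    using t by (auto intro!: bij_betwI[of _ _ _ "\<lambda>r. t *\<^sub>R r"] linearI simp: scaleR_add_right)
qed

lemma cfourier_scale:
  fixes h :: "real ^ 'n \<Rightarrow> complex"
  assumes h: "decays h" and t: "t > 0"
  shows "cfourier (\<lambda>r. h (r /\<^sub>R t)) k = of_real (t ^ CARD('n)) * cfourier h (t *\<^sub>R k)"
proof -
  have "decays (\<lambda>r. h (r /\<^sub>R t))" using h t by (rule decays_scale)
  then have "cfourier (\<lambda>r. h (r /\<^sub>R t)) k
      = of_real (t ^ CARD('n)) * (LINT r|lborel. h ((t *\<^sub>R r) /\<^sub>R t) * wave (- k) (t *\<^sub>R r))"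
    unfolding cfourier_def
    by (intro lebesgue_integral_scale decays_borel_measurable decays_wave t)
  then show ?thesis using t by (simp add: cfourier_def wave_def)
qed

lemma bigo_at_infinity_imp_decays:
  fixes f :: "real ^ 'n \<Rightarrow> real"
  assumes cont: "continuous_on UNIV f" and "\<delta> > 0"
    and O: "f \<in> O[at_infinity](\<lambda>x. (1 + norm x) powr (- real CARD('n) - \<delta>))"
  shows "decays (\<lambda>x. complex_of_real (f x))"
proof -
  define p where "p = real CARD('n) + \<delta>"
  have "p > 0" using \<open>\<delta> > 0\<close> by (simp add: p_def add_pos_pos)
  have "f \<in> O[at_infinity](\<lambda>x. (1 + norm x) powr (- p))" using O by (simp add: p_def)
  then obtain c where c: "c > 0"
    "eventually (\<lambda>x. norm (f x) \<le> c * norm ((1 + norm x) powr (- p))) at_infinity"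
    by (elim landau_o.bigE)
  then obtain b0 where b0: "\<And>x. norm x \<ge> b0 \<Longrightarrow> \<bar>f x\<bar> \<le> c * (1 + norm x) powr (- p)"
    by (auto simp: eventually_at_infinity)
  define b where "b = max b0 0"
  have b: "\<And>x. norm x \<ge> b \<Longrightarrow> \<bar>f x\<bar> \<le> c * (1 + norm x) powr (- p)" "b \<ge> 0"
    using b0 by (auto simp: b_def)
  have "bounded (f ` cball 0 b)"
    by (intro compact_imp_bounded compact_continuous_image continuous_on_subset[OF cont]) auto
  then obtain K where K: "K > 0" "\<And>x. norm x \<le> b \<Longrightarrow> \<bar>f x\<bar> \<le> K"
    by (auto simp: bounded_pos)
  define C where "C = max c (K * (1 + b) powr p)"
  have "\<bar>f x\<bar> \<le> C * (1 + norm x) powr (- p)" for x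
  proof (cases "norm x \<ge> b")
    case True
    then have "\<bar>f x\<bar> \<le> c * (1 + norm x) powr (- p)" by (rule b)
    also have "\<dots> \<le> C * (1 + norm x) powr (- p)"
      by (intro mult_right_mono) (auto simp: C_def)
    finally show ?thesis .
  next
    case False
    \<comment> \<open>Inside the ball, continuity bounds \<open>f\<close>, and the power is bounded below by its value on the sphere.\<close>
    have "K = (K * (1 + b) powr p) * (1 + b) powr (- p)"
      using b(2) by (simp add: powr_minus)
    also have "\<dots> \<le> C * (1 + norm x) powr (- p)"
      using False \<open>p > 0\<close> c(1) by (intro mult_mono powr_mono2') (auto simp: C_def add_pos_nonneg)
    finally show ?thesis using K(2)[of x] False by simp
  qed
  then have "\<forall>x. norm (complex_of_real (f x)) \<le> C * (1 + norm x) powr (- real CARD('n) - \<delta>)"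
    by (simp add: p_def)
  then show ?thesis
    using \<open>\<delta> > 0\<close> continuous_on_of_real[OF cont] unfolding decays_def by blast
qed

lemma infsum_ennreal_eq:
  assumes "f summable_on A" "\<And>x. x \<in> A \<Longrightarrow> 0 \<le> f x"
  shows "(\<Sum>\<^sub>\<infinity>x\<in>A. ennreal (f x)) = ennreal (\<Sum>\<^sub>\<infinity>x\<in>A. f x)"
proof (rule infsumI)
  have "(sum f \<longlongrightarrow> infsum f A) (finite_subsets_at_top A)"
    using has_sum_infsum[OF assms(1)] by (simp add: has_sum_def)
  then have "((\<lambda>F. ennreal (sum f F)) \<longlongrightarrow> ennreal (infsum f A)) (finite_subsets_at_top A)"
    by (rule tendsto_ennrealI)
  moreover have "\<forall>\<^sub>F F in finite_subsets_at_top A. ennreal (sum f F) = (\<Sum>x\<in>F. ennreal (f x))"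
    using assms(2) by (intro eventually_finite_subsets_at_top_weakI) (subst sum_ennreal, auto)
  ultimately show "((\<lambda>x. ennreal (f x)) has_sum ennreal (infsum f A)) A"
    unfolding has_sum_def using Lim_transform_eventually by blast
qed

lemma infsum_complex_of_real:
  assumes "f summable_on A"
  shows "(\<Sum>\<^sub>\<infinity>x\<in>A. complex_of_real (f x)) = complex_of_real (\<Sum>\<^sub>\<infinity>x\<in>A. f x)"
  using assms by (intro infsumI has_sum_of_real has_sum_infsum)

section \<open>Bounds for translated and scaled lattice sums\<close>

text \<open>The hypotheses for one fixed lattice, with the growth condition already turned into \<^const>\<open>decays\<close>.\<close>

locale ray_decreasing_transform =
  fixes f :: "real ^ 'n \<Rightarrow> real" and L :: "(real ^ 'n) set"
  assumes f_pos: "\<And>x. f x > 0"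
    and f_decays: "decays (\<lambda>x. complex_of_real (f x))"
    and fhat_summable: "\<And>t. t > 0 \<Longrightarrow> (\<lambda>l. norm (fourier f (t *\<^sub>R l))) summable_on dual_lattice L"
    and fhat_real: "\<And>v. fourier f v \<in> \<real>"
    and fhat_rays: "\<And>v t. t \<ge> 1 \<Longrightarrow>
          0 \<le> Re (fourier f (t *\<^sub>R v)) \<and> Re (fourier f (t *\<^sub>R v)) \<le> Re (fourier f v)"
    and L: "is_lattice L"
begin

definition mass :: real where "mass = (\<Sum>\<^sub>\<infinity>l\<in>L. f l)"

lemma fhat_nonneg: "0 \<le> Re (fourier f v)"
  using fhat_rays[of 1 v] by simp

lemma norm_fhat: "norm (fourier f v) = \<bar>Re (fourier f v)\<bar>"
  using fhat_real[of v] by (auto elim!: Reals_cases)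

lemma fhat_of_real: "fourier f v = of_real (Re (fourier f v))"
  using fhat_real[of v] by (auto elim!: Reals_cases)

lemma summable_scaled:
  assumes "t > 0"
  shows "(\<lambda>l. f ((l + v) /\<^sub>R t)) summable_on L"
  using decays_summable_on_lattice[OF decays_scale[OF f_decays assms] L, of v] f_pos
  by (simp add: abs_of_pos)

lemma summable_shifted: "(\<lambda>l. f (l + v)) summable_on L"
  using summable_scaled[of 1] by simp

lemma summable_lattice: "f summable_on L"
  using summable_shifted[of 0] by simp

lemma zero_in_lattice: "0 \<in> L"
proof -
  obtain A :: "real ^ 'n \<Rightarrow> real ^ 'n" where "linear A" "L = A ` integer_points"
    by (rule lattice_parametrization[OF L])
  then show ?thesis using linear_0 integer_points_closed(1) by (metis imageI)
qed

lemma mass_pos: "mass > 0"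
proof -
  have "f 0 = infsum f {0}" by simp
  also have "\<dots> \<le> mass"
    unfolding mass_def using zero_in_lattice summable_lattice f_pos
    by (intro infsum_mono_neutral) (auto intro: less_imp_le)
  finally show ?thesis using f_pos[of 0] by linarith
qed

lemma poisson_mass:
  obtains D where "D > 0"
    "\<And>h v. decays h \<Longrightarrow> (\<lambda>k. norm (cfourier h k)) summable_on dual_lattice L \<Longrightarrow>
      (\<Sum>\<^sub>\<infinity>l\<in>L. h (l + v)) = complex_of_real D * (\<Sum>\<^sub>\<infinity>k\<in>dual_lattice L. cfourier h k * wave k v)"
    "mass = D * (\<Sum>\<^sub>\<infinity>k\<in>dual_lattice L. Re (fourier f k))"
proof -
  obtain D where D: "D > 0" and poisson:
    "\<And>h v. decays h \<Longrightarrow> (\<lambda>k. norm (cfourier h k)) summable_on dual_lattice L \<Longrightarrow>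
      (\<Sum>\<^sub>\<infinity>l\<in>L. h (l + v)) = complex_of_real D * (\<Sum>\<^sub>\<infinity>k\<in>dual_lattice L. cfourier h k * wave k v)"
    by (rule poisson_lattice[OF L]) blast
  have fh: "cfourier (\<lambda>r. complex_of_real (f r)) k = of_real (Re (fourier f k))" for k
    unfolding fourier_eq_cfourier[symmetric] by (rule fhat_of_real)
  have sm: "(\<lambda>k. Re (fourier f k)) summable_on dual_lattice L"
    using fhat_summable[of 1] by (simp add: norm_fhat fhat_nonneg)
  have "complex_of_real mass = (\<Sum>\<^sub>\<infinity>l\<in>L. complex_of_real (f (l + 0)))"
    unfolding mass_def using infsum_complex_of_real[OF summable_lattice] by simp
  also have "\<dots> = complex_of_real D * (\<Sum>\<^sub>\<infinity>k\<in>dual_lattice L. complex_of_real (Re (fourier f k)))"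
    using sm by (subst poisson[OF f_decays]) (simp_all add: fh fhat_nonneg)
  also have "\<dots> = complex_of_real (D * (\<Sum>\<^sub>\<infinity>k\<in>dual_lattice L. Re (fourier f k)))"
    by (simp add: infsum_complex_of_real[OF sm])
  finally have "mass = D * (\<Sum>\<^sub>\<infinity>k\<in>dual_lattice L. Re (fourier f k))"
    using of_real_eq_iff by blast
  with D poisson show thesis by (rule that)
qed

text \<open>On the side of the dual lattice, the translation by \<open>v\<close> only multiplies the terms by numbers of absolute
  value one, and the dilation by \<open>t \<ge> 1\<close> moves the argument of the transform outwards along rays, which
  decreases it. The factor \<open>t ^ n\<close> comes from the transform of the dilated function.\<close>

lemma scaled_translate_le:
  assumes t: "t \<ge> 1"
  shows "(\<Sum>\<^sub>\<infinity>l\<in>L. f ((l + v) /\<^sub>R t)) \<le> t ^ CARD('n) * mass"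
proof -
  obtain D where D: "D > 0" and poisson:
    "\<And>h v. decays h \<Longrightarrow> (\<lambda>k. norm (cfourier h k)) summable_on dual_lattice L \<Longrightarrow>
      (\<Sum>\<^sub>\<infinity>l\<in>L. h (l + v)) = complex_of_real D * (\<Sum>\<^sub>\<infinity>k\<in>dual_lattice L. cfourier h k * wave k v)"
    and mass: "mass = D * (\<Sum>\<^sub>\<infinity>k\<in>dual_lattice L. Re (fourier f k))"
    by (rule poisson_mass) blast
  have "t > 0" using t by simp
  define F where "F k = Re (fourier f k)" for k
  have F: "fourier f k = of_real (F k)" "0 \<le> F k" "norm (fourier f k) = F k" for k
    using fhat_of_real[of k] fhat_nonneg[of k] norm_fhat[of k] by (simp_all add: F_def)
  have smF: "(\<lambda>k. F (s *\<^sub>R k)) summable_on dual_lattice L" if "s > 0" for s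
    using fhat_summable[OF that] by (simp add: F)
  define h where "h r = complex_of_real (f (r /\<^sub>R t))" for r
  have h: "decays h" unfolding h_def by (rule decays_scale[OF f_decays \<open>t > 0\<close>])
  have fh: "cfourier h k = of_real (t ^ CARD('n) * F (t *\<^sub>R k))" for k
    unfolding h_def cfourier_scale[OF f_decays \<open>t > 0\<close>] by (simp add: fourier_eq_cfourier[symmetric] F)
  have smh: "(\<lambda>k. norm (cfourier h k * w k)) summable_on dual_lattice L" if "\<And>k. norm (w k) = 1" for w
    unfolding norm_mult fh that using \<open>t > 0\<close> F(2)
    by (simp add: summable_on_cmult_right smF abs_mult abs_of_nonneg del: of_real_mult of_real_power)
  have "complex_of_real (\<Sum>\<^sub>\<infinity>l\<in>L. f ((l + v) /\<^sub>R t)) = (\<Sum>\<^sub>\<infinity>l\<in>L. h (l + v))"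
    unfolding h_def by (rule infsum_complex_of_real[symmetric, OF summable_scaled[OF \<open>t > 0\<close>]])
  also have "\<dots> = complex_of_real D * (\<Sum>\<^sub>\<infinity>k\<in>dual_lattice L. cfourier h k * wave k v)"
    using smh[of "\<lambda>_. 1"] by (intro poisson h) simp
  finally have poisson_h: "complex_of_real (\<Sum>\<^sub>\<infinity>l\<in>L. f ((l + v) /\<^sub>R t))
      = complex_of_real D * (\<Sum>\<^sub>\<infinity>k\<in>dual_lattice L. cfourier h k * wave k v)" .
  have "\<bar>\<Sum>\<^sub>\<infinity>l\<in>L. f ((l + v) /\<^sub>R t)\<bar> = norm (complex_of_real (\<Sum>\<^sub>\<infinity>l\<in>L. f ((l + v) /\<^sub>R t)))"
    by (rule norm_of_real[symmetric])
  also have "\<dots> = D * norm (\<Sum>\<^sub>\<infinity>k\<in>dual_lattice L. cfourier h k * wave k v)"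
    unfolding poisson_h using D by (simp add: norm_mult)
  also have "\<dots> \<le> D * (\<Sum>\<^sub>\<infinity>k\<in>dual_lattice L. norm (cfourier h k * wave k v))"
    using D by (intro mult_left_mono norm_infsum_bound smh) auto
  also have "(\<Sum>\<^sub>\<infinity>k\<in>dual_lattice L. norm (cfourier h k * wave k v)) = (\<Sum>\<^sub>\<infinity>k\<in>dual_lattice L. t ^ CARD('n) * F (t *\<^sub>R k))"
    using \<open>t > 0\<close> F(2) by (simp add: norm_mult fh abs_mult abs_of_nonneg del: of_real_mult of_real_power)
  also have "\<dots> \<le> (\<Sum>\<^sub>\<infinity>k\<in>dual_lattice L. t ^ CARD('n) * F k)"
    using smF[OF \<open>t > 0\<close>] smF[of 1] \<open>t > 0\<close> fhat_rays[OF t]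
    by (intro infsum_mono summable_on_cmult_right mult_left_mono) (auto simp: F_def)
  finally have "\<bar>\<Sum>\<^sub>\<infinity>l\<in>L. f ((l + v) /\<^sub>R t)\<bar> \<le> D * (\<Sum>\<^sub>\<infinity>k\<in>dual_lattice L. t ^ CARD('n) * F k)"
    using D by simp
  also have "\<dots> = t ^ CARD('n) * mass"
    by (simp add: infsum_cmult_right' mass F_def)
  finally show ?thesis by linarith
qed

text \<open>Outside \<open>K\<close> the function is at most \<open>c u ^ n\<close> times its dilate by \<open>1 / u\<close>, and summing that dilate over
  the translated lattice costs a factor \<open>(1 / u) ^ n\<close>, which cancels \<open>u ^ n\<close>.\<close>

lemma complement_le:
  assumes u: "0 < u" "u \<le> 1" and c: "0 \<le> c"
    and bound: "\<And>x. x \<notin> K \<Longrightarrow> f x \<le> c * (u ^ CARD('n) * f (u *\<^sub>R x))"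
  shows "(\<Sum>\<^sub>\<infinity>l\<in>{l \<in> L. l + v \<notin> K}. f (l + v)) \<le> c * mass"
proof -
  have sm: "(\<lambda>l. f (u *\<^sub>R (l + v))) summable_on L"
    using summable_scaled[of "1 / u" v] u by simp
  have "(\<Sum>\<^sub>\<infinity>l\<in>{l \<in> L. l + v \<notin> K}. f (l + v)) \<le> (\<Sum>\<^sub>\<infinity>l\<in>L. (c * u ^ CARD('n)) * f (u *\<^sub>R (l + v)))"
  proof (rule infsum_mono_neutral)
    show "(\<lambda>l. f (l + v)) summable_on {l \<in> L. l + v \<notin> K}"
      by (rule summable_on_subset_banach[OF summable_shifted]) auto
    show "(\<lambda>l. (c * u ^ CARD('n)) * f (u *\<^sub>R (l + v))) summable_on L"
      using sm by (rule summable_on_cmult_right)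
  qed (use bound c u f_pos in \<open>auto simp: mult.assoc less_imp_le\<close>)
  also have "\<dots> = (c * u ^ CARD('n)) * (\<Sum>\<^sub>\<infinity>l\<in>L. f (u *\<^sub>R (l + v)))"
    by (rule infsum_cmult_right')
  also have "\<dots> \<le> (c * u ^ CARD('n)) * ((1 / u) ^ CARD('n) * mass)"
    using scaled_translate_le[of "1 / u" v] u c by (intro mult_left_mono) auto
  also have "\<dots> = c * mass"
    using u by (simp add: power_one_over)
  finally show ?thesis .
qed

text \<open>The bound above holds for every \<open>u\<close> with a finite supremum. As \<^term>\<open>mass\<close> is finite and positive, it can be
  divided out, which turns the claim into a lower bound for an infimum.\<close>

lemma complement_le_nu:
  "(\<Sum>\<^sub>\<infinity>l\<in>{l \<in> L. l + v \<notin> K}. ennreal (f (l + v))) \<le> nu f K * ennreal mass"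
proof -
  let ?X = "\<Sum>\<^sub>\<infinity>l\<in>{l \<in> L. l + v \<notin> K}. f (l + v)"
  have eq: "(\<Sum>\<^sub>\<infinity>l\<in>{l \<in> L. l + v \<notin> K}. ennreal (f (l + v))) = ennreal ?X"
    using f_pos
    by (intro infsum_ennreal_eq summable_on_subset_banach[OF summable_shifted]) (auto intro: less_imp_le)
  have "ennreal (?X / mass) \<le> (SUP x\<in>- K. ennreal (f x / (u ^ CARD('n) * f (u *\<^sub>R x))))"
    (is "_ \<le> ?s") if u: "u \<in> {0<..1}" for u
  proof (cases ?s)
    case (real c)
    have "f x \<le> c * (u ^ CARD('n) * f (u *\<^sub>R x))" if "x \<notin> K" for x
    proof -
      have "ennreal (f x / (u ^ CARD('n) * f (u *\<^sub>R x))) \<le> ennreal c"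
        unfolding real(2)[symmetric] using that by (intro SUP_upper) simp
      then have "f x / (u ^ CARD('n) * f (u *\<^sub>R x)) \<le> c" using real(1) by simp
      then show ?thesis using u f_pos[of "u *\<^sub>R x"] by (simp add: pos_divide_le_eq)
    qed
    then have "?X \<le> c * mass" using u real(1) by (intro complement_le) auto
    then show ?thesis
      unfolding real(2) using mass_pos by (intro ennreal_leI) (simp add: pos_divide_le_eq)
  next
    case top
    show ?thesis unfolding top by simp
  qed
  then have "ennreal (?X / mass) \<le> nu f K"
    unfolding nu_def by (rule INF_greatest)
  then have "ennreal (?X / mass) * ennreal mass \<le> nu f K * ennreal mass"
    by (rule mult_right_mono) simp
  moreover have "0 \<le> ?X" by (rule infsum_nonneg) (simp add: f_pos less_imp_le)
  ultimately show ?thesis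
    using mass_pos by (simp add: eq ennreal_mult[symmetric])
qed

text \<open>Up to the factor \<open>D\<close>, the left-hand sum of the transform is \<^term>\<open>mass\<close> and the right-hand one is the
  sum of \<open>f\<close> over the lattice twisted by a character. The character equals one at the origin and has real
  part at least \<open>- 1\<close> elsewhere, so the twisted sum loses at most twice the mass of the nonzero
  vectors. These all lie outside \<open>K\<close>, so their mass is controlled by the previous bound.\<close>

lemma shifted_transform_ge:
  assumes K: "\<And>l. l \<in> L \<Longrightarrow> l \<noteq> 0 \<Longrightarrow> l \<notin> K"
    and sm: "(\<lambda>l. Re (fourier f (l + v))) summable_on dual_lattice L"
    and fin: "nu f K < \<infinity>"
  shows "(1 - 2 * enn2real (nu f K)) * (\<Sum>\<^sub>\<infinity>l\<in>dual_lattice L. Re (fourier f l))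
    \<le> (\<Sum>\<^sub>\<infinity>l\<in>dual_lattice L. Re (fourier f (l + v)))"
proof -
  obtain D where D: "D > 0" and poisson:
    "\<And>h v. decays h \<Longrightarrow> (\<lambda>k. norm (cfourier h k)) summable_on dual_lattice L \<Longrightarrow>
      (\<Sum>\<^sub>\<infinity>l\<in>L. h (l + v)) = complex_of_real D * (\<Sum>\<^sub>\<infinity>k\<in>dual_lattice L. cfourier h k * wave k v)"
    and total: "mass = D * (\<Sum>\<^sub>\<infinity>k\<in>dual_lattice L. Re (fourier f k))"
    by (rule poisson_mass) blast
  have twisted: "(\<Sum>\<^sub>\<infinity>l\<in>L. complex_of_real (f l) * wave (- v) l)
      = complex_of_real (D * (\<Sum>\<^sub>\<infinity>k\<in>dual_lattice L. Re (fourier f (k + v))))"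
  proof -
    define h where "h r = complex_of_real (f r) * wave (- v) r" for r
    have h: "decays h" unfolding h_def by (rule decays_wave[OF f_decays])
    have fh: "cfourier h k = of_real (Re (fourier f (k + v)))" for k
      unfolding h_def cfourier_wave_shift fourier_eq_cfourier[symmetric] by (rule fhat_of_real)
    have "(\<lambda>k. norm (cfourier h k)) summable_on dual_lattice L"
      using sm by (simp add: fh fhat_nonneg)
    from poisson[OF h this, of 0] show ?thesis
      by (simp add: h_def[symmetric] fh infsum_complex_of_real[OF sm])
  qed
  define R where "R = (\<Sum>\<^sub>\<infinity>l\<in>L - {0}. f l)"
  have smR: "f summable_on L - {0}" by (rule summable_on_subset_banach[OF summable_lattice]) auto
  have R: "R \<le> enn2real (nu f K) * mass"
  proof -
    have "ennreal R = (\<Sum>\<^sub>\<infinity>l\<in>L - {0}. ennreal (f l))"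
      unfolding R_def using f_pos by (intro infsum_ennreal_eq[symmetric] smR) (auto intro: less_imp_le)
    also have "\<dots> \<le> (\<Sum>\<^sub>\<infinity>l\<in>{l \<in> L. l + 0 \<notin> K}. ennreal (f (l + 0)))"
      using K by (intro infsum_mono_neutral nonneg_summable_on_complete) auto
    also have "\<dots> \<le> nu f K * ennreal mass" by (rule complement_le_nu)
    also have "\<dots> = ennreal (enn2real (nu f K) * mass)"
      using fin mass_pos by (simp add: ennreal_mult)
    finally show ?thesis using mass_pos by simp
  qed
  have smw: "(\<lambda>l. complex_of_real (f l) * wave (- v) l) summable_on L"
  proof (rule abs_summable_summable)
    show "(\<lambda>l. norm (complex_of_real (f l) * wave (- v) l)) summable_on L"
      using summable_lattice f_pos by (simp add: norm_mult abs_of_pos)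
  qed
  have split: "mass = f 0 + R"
    unfolding mass_def R_def
    using zero_in_lattice summable_lattice infsum_Diff[OF summable_lattice, of "{0}"] by simp
  \<comment> \<open>The origin contributes \<open>f 0\<close>, every other term at least \<open>- f l\<close>.\<close>
  have "f 0 - R \<le> (\<Sum>\<^sub>\<infinity>l\<in>L. Re (complex_of_real (f l) * wave (- v) l))"
  proof -
    have "f 0 - R = f 0 + (\<Sum>\<^sub>\<infinity>l\<in>L - {0}. - f l)"
      by (simp add: R_def infsum_uminus)
    also have "\<dots> \<le> f 0 + (\<Sum>\<^sub>\<infinity>l\<in>L - {0}. Re (complex_of_real (f l) * wave (- v) l))"
    proof (intro add_left_mono infsum_mono)
      show "(\<lambda>l. - f l) summable_on L - {0}" using smR by (simp add: summable_on_uminus)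
      show "(\<lambda>l. Re (complex_of_real (f l) * wave (- v) l)) summable_on L - {0}"
        by (rule summable_on_subset_banach[OF summable_on_Re[OF smw]]) auto
      fix l
      have "- 1 \<le> Re (wave (- v) l)"
        using abs_Re_le_cmod[of "wave (- v) l"] by simp
      then show "- f l \<le> Re (complex_of_real (f l) * wave (- v) l)"
        using mult_left_mono[of "- 1" _ "f l"] f_pos[of l] by (simp add: less_imp_le)
    qed
    also have "\<dots> = (\<Sum>\<^sub>\<infinity>l\<in>L. Re (complex_of_real (f l) * wave (- v) l))"
      using zero_in_lattice infsum_Diff[OF summable_on_Re[OF smw], of "{0}"] by simp
    finally show ?thesis .
  qed
  also have "\<dots> = D * (\<Sum>\<^sub>\<infinity>k\<in>dual_lattice L. Re (fourier f (k + v)))"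
    using infsum_Re[OF smw] twisted by simp
  finally have "(1 - 2 * enn2real (nu f K)) * mass \<le> D * (\<Sum>\<^sub>\<infinity>k\<in>dual_lattice L. Re (fourier f (k + v)))"
    using R split by (simp add: algebra_simps)
  then have "D * ((1 - 2 * enn2real (nu f K)) * (\<Sum>\<^sub>\<infinity>l\<in>dual_lattice L. Re (fourier f l)))
      \<le> D * (\<Sum>\<^sub>\<infinity>k\<in>dual_lattice L. Re (fourier f (k + v)))"
    unfolding total by (simp add: mult_ac)
  then show ?thesis using D by simp
qed

end

theorem theorem2p3:
  fixes f :: "real ^ 'n \<Rightarrow> real" and L :: "(real ^ 'n) set"
  assumes f_pos: "\<And>x. f x > 0"
    and f_cont: "continuous_on UNIV f"
    and f_decay: "\<exists>\<delta>>0. f \<in> O[at_infinity](\<lambda>x. (1 + norm x) powr (- real CARD('n) - \<delta>))"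
    and fhat_summable: "\<And>M t. is_lattice M \<Longrightarrow> t > 0 \<Longrightarrow>
          (\<lambda>l. norm (fourier f (t *\<^sub>R l))) summable_on dual_lattice M"
    and fhat_real: "\<And>v. fourier f v \<in> \<real>"
    and fhat_rays: "\<And>v t. t \<ge> 1 \<Longrightarrow>
          0 \<le> Re (fourier f (t *\<^sub>R v)) \<and> Re (fourier f (t *\<^sub>R v)) \<le> Re (fourier f v)"
    and L: "is_lattice L"
  shows
    "(\<forall>v t. t \<ge> 1 \<longrightarrow>
        (\<Sum>\<^sub>\<infinity>l\<in>L. ennreal (f ((l + v) /\<^sub>R t))) \<le> ennreal (t ^ CARD('n)) * (\<Sum>\<^sub>\<infinity>l\<in>L. ennreal (f l)))
   \<and> (\<forall>K v. nu f K * (\<Sum>\<^sub>\<infinity>l\<in>L. ennreal (f l)) < \<infinity> \<longrightarrow>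
        (\<Sum>\<^sub>\<infinity>l\<in>{l \<in> L. l + v \<notin> K}. ennreal (f (l + v))) \<le> nu f K * (\<Sum>\<^sub>\<infinity>l\<in>L. ennreal (f l)))
   \<and> (\<forall>K v. (\<forall>l\<in>L. l \<noteq> 0 \<longrightarrow> l \<notin> K) \<longrightarrow>
        (\<lambda>l. Re (fourier f (l + v))) summable_on dual_lattice L \<longrightarrow> nu f K < \<infinity> \<longrightarrow>
        (\<Sum>\<^sub>\<infinity>l\<in>dual_lattice L. Re (fourier f (l + v)))
          \<ge> (1 - 2 * enn2real (nu f K)) * (\<Sum>\<^sub>\<infinity>l\<in>dual_lattice L. Re (fourier f l)))"
proof -
  interpret ray_decreasing_transform f L
  proof
    obtain \<delta> where "\<delta> > 0" "f \<in> O[at_infinity](\<lambda>x. (1 + norm x) powr (- real CARD('n) - \<delta>))"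
      using f_decay by (elim exE conjE)
    then show "decays (\<lambda>x. complex_of_real (f x))"
      by (rule bigo_at_infinity_imp_decays[OF f_cont])
  qed (use f_pos fhat_summable[OF L] fhat_real fhat_rays L in auto)
  have mass: "(\<Sum>\<^sub>\<infinity>l\<in>L. ennreal (f l)) = ennreal mass"
    unfolding mass_def using summable_lattice f_pos by (intro infsum_ennreal_eq) (auto intro: less_imp_le)
  have scaled: "(\<Sum>\<^sub>\<infinity>l\<in>L. ennreal (f ((l + v) /\<^sub>R t))) \<le> ennreal (t ^ CARD('n)) * ennreal mass" if "t \<ge> 1" for v t
  proof -
    have "(\<Sum>\<^sub>\<infinity>l\<in>L. ennreal (f ((l + v) /\<^sub>R t))) = ennreal (\<Sum>\<^sub>\<infinity>l\<in>L. f ((l + v) /\<^sub>R t))"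
      using that by (intro infsum_ennreal_eq summable_scaled) (simp_all add: f_pos less_imp_le)
    also have "\<dots> \<le> ennreal (t ^ CARD('n) * mass)"
      using that by (intro ennreal_leI scaled_translate_le)
    finally show ?thesis using that mass_pos by (simp add: ennreal_mult)
  qed
  show ?thesis
    unfolding mass
    by (intro conjI allI impI scaled complement_le_nu shifted_transform_ge) auto
qed

end
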